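(* There is no nontrivial uniquely $C_9$-saturated graph. That is, there is no finite simple graph $G$ with at least $9$ vertices such that $G$ contains no cycle of length $9$ and, for every edge $e$ of the complement $\overline{G}$, the graph $G+e$ contains exactly one cycle of length $9$.
   Context: All graphs are finite and simple. $C_t$ denotes the cycle on $t$ vertices. A graph $G$ is uniquely $C_t$-saturated if $G$ contains no cycle of length $t$ (as a not necessarily induced subgraph) and, for every edge $e$ of the complement $\overline{G}$, the graph $G+e$ contains exactly one cycle of length $t$ (cycles counted as subgraphs). A uniquely $C_t$-saturated graph is nontrivial if it has at least $t$ vertices. *)

theory Defs
  imports "Graph_Theory.Graph_Theory"
begin

text \<open>
  As in the Graph_Theory library, a finite simple graph is a finite, loop-free, symmetric digraph
  without parallel arcs (locale pair_graph): the undirected edge uv is the pair of arcs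
  (u,v), (v,u).
\<close>

text \<open>The graph C_t (meaningful for t at least 3).\<close>

definition cycle_graph :: "nat \<Rightarrow> nat pair_pre_digraph" where
  "cycle_graph t = \<lparr> pverts = {..<t},
     parcs = {(i, j). i < t \<and> j < t \<and> (j = Suc i mod t \<or> i = Suc j mod t)} \<rparr>"

text \<open>
  Cycles are counted as subgraphs, i.e. as vertex set together with edge set, without start vertex
  or orientation. Since H must be a pair_graph, its arc set is symmetric, so H is determined by its
  undirected edges.
\<close>

definition cycle_in :: "nat \<Rightarrow> 'a pair_pre_digraph \<Rightarrow> 'a pair_pre_digraph \<Rightarrow> bool" where
  "cycle_in t G H \<longleftrightarrow> pair_graph H \<and> subgraph (with_proj H) (with_proj G)
     \<and> digraph_iso (with_proj (cycle_graph t)) (with_proj H)"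

definition add_edge :: "'a pair_pre_digraph \<Rightarrow> 'a \<Rightarrow> 'a \<Rightarrow> 'a pair_pre_digraph" where
  "add_edge G u v = G\<lparr> parcs := parcs G \<union> {(u, v), (v, u)} \<rparr>"

definition uniquely_cycle_saturated :: "nat \<Rightarrow> 'a pair_pre_digraph \<Rightarrow> bool" where
  "uniquely_cycle_saturated t G \<longleftrightarrow> pair_graph G \<and> (\<nexists>H. cycle_in t G H)
     \<and> (\<forall>u\<in>pverts G. \<forall>v\<in>pverts G. u \<noteq> v \<and> (u, v) \<notin> parcs G
          \<longrightarrow> (\<exists>!H. cycle_in t (add_edge G u v) H))"

definition nontrivial_uniquely_cycle_saturated :: "nat \<Rightarrow> 'a pair_pre_digraph \<Rightarrow> bool" where
  "nontrivial_uniquely_cycle_saturated t G \<longleftrightarrow>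
     uniquely_cycle_saturated t G \<and> t \<le> card (pverts G)"

end

theory Submission
  imports Defs
begin

text \<open>In a graph without nine-cycles, the nine-cycles created by a new edge \<open>uv\<close> are the paths with eight
edges from \<open>u\<close> to \<open>v\<close>, closed up by \<open>uv\<close>. So in a uniquely saturated graph any two non-adjacent
vertices are joined by exactly one path of length eight, and adjacent vertices by none, since such a
path would close up to a nine-cycle. Hence \<^emph>\<open>two different paths of length eight never have the same
ends\<close>. This is what the locale \<open>unique_eight_paths\<close> states.

This condition pulls in two directions. It forbids a lot: opposite vertices of a cycle of length
\<open>2 l\<close> are joined by two paths of length \<open>l\<close>, so two disjoint paths that leave the cycle at opposite
vertices and have total length \<open>8 - l\<close> cannot exist. On the other hand non-adjacent vertices force a
path of length eight, that is, further edges and vertices near by. A small configuration in a graph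
can therefore often be refuted by a finite case analysis: choose two non-adjacent vertices and follow
the path between them step by step; each new edge either closes a nine-cycle, or produces two paths
of length eight with common ends, or contains a configuration that is already excluded, or the
analysis goes on with another pair. Such an analysis is recorded as a certificate, a list of
instructions; the function \<open>run\<close> executes it and the theorem \<open>forbidden_if_refutes\<close> says that a
configuration with a successful certificate occurs in no graph of the locale.

What remains is to exclude configurations in a good order. Let \<open>Q\<close> be a largest clique, with \<open>m\<close>
vertices. Then \<open>m \<le> 8\<close>, as a clique of nine vertices contains a nine-cycle. As there are at least nine
vertices and the graph is connected, some vertex \<open>w\<close> outside \<open>Q\<close> has a neighbour \<open>x\<close> in \<open>Q\<close>. If \<open>w\<close> had
two neighbours in \<open>Q\<close>, they would form, with \<open>w\<close> and a non-neighbour of \<open>w\<close> in \<open>Q\<close>, an induced diamond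
(a four-cycle with exactly one chord), and diamonds can be refuted. So \<open>w\<close> is adjacent to \<open>x\<close> only, and
it suffices to refute, for \<open>m = 8, 7, \<dots>, 2\<close>, a clique of \<open>m\<close> vertices with such a pendant vertex
(\<open>forbidden_clique_step\<close>).

For \<open>m \<ge> 4\<close> this is possible because there are so many ways through a clique. Then there is no clique
of four vertices, and as induced diamonds and induced four-cycles are excluded, there is no four-cycle
at all. This makes the case \<open>m = 3\<close> tractable, with a few pairs of cycles that share an edge as
intermediate steps. In the absence of triangles and four-cycles, cycles of length five, ten and eight
can be refuted. Finally, for \<open>m = 2\<close>, let \<open>w x y\<close> be an induced path. The path of length eight from \<open>w\<close> to \<open>y\<close> either avoids \<open>x\<close> and
closes up to a ten-cycle, or it visits \<open>x\<close> after \<open>a\<close> steps; then its two parts close up to cycles of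
length \<open>a + 1\<close> and \<open>9 - a\<close>, where a part of length one is an edge, and for each \<open>a\<close> one of these is a
triangle or a cycle of length four, five or eight. So there are no edges, which is absurd.\<close>

section \<open>Graphs with unique paths of length eight\<close>

definition simple_path :: "('a \<Rightarrow> 'a \<Rightarrow> bool) \<Rightarrow> 'a list \<Rightarrow> bool" where
  "simple_path R p \<longleftrightarrow> distinct p \<and> successively R p"

text \<open>Paths are lists of vertices, so paths of length eight are lists of length nine. The assumption
\<open>unique_path\<close> speaks of arbitrary ends: paths of length eight with adjacent ends do not exist by
\<open>no_nine_cycle\<close>.\<close>

locale unique_eight_paths =
  fixes verts :: "'a set" and adj :: "'a \<Rightarrow> 'a \<Rightarrow> bool"
  assumes nine_verts: "9 \<le> card verts"
    and adj_sym: "adj x y \<Longrightarrow> adj y x"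
    and adj_irrefl: "\<not> adj x x"
    and adj_verts: "adj x y \<Longrightarrow> x \<in> verts"
    and no_nine_cycle: "simple_path adj p \<Longrightarrow> length p = 9 \<Longrightarrow> \<not> adj (last p) (hd p)"
    and unique_path: "simple_path adj p \<Longrightarrow> simple_path adj q \<Longrightarrow> length p = 9 \<Longrightarrow> length q = 9
      \<Longrightarrow> hd p = hd q \<Longrightarrow> last p = last q \<Longrightarrow> p = q"
    and ex_path: "x \<in> verts \<Longrightarrow> y \<in> verts \<Longrightarrow> x \<noteq> y \<Longrightarrow> \<not> adj x y
      \<Longrightarrow> \<exists>p. simple_path adj p \<and> length p = 9 \<and> hd p = x \<and> last p = y"

section \<open>Configurations and their refutations\<close>

text \<open>A configuration consists of its vertices, named by letters, of walks that run along edges and of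
walks whose consecutive vertices are non-adjacent. Nothing is said about the other pairs.\<close>

type_synonym config = "string \<times> string list \<times> string list"

text \<open>Symmetric relations on the letters, as lists of neighbours; one such table holds the pairs known to be
adjacent and another one the pairs known to be non-adjacent.\<close>

type_synonym table = "(char \<times> string) list"

text \<open>A conditional that has both alternatives evaluated. Certificates are evaluated by rewriting, where an
alternative chosen by an ordinary conditional would be normalized all over again, at a cost
quadratic in the length of a table.\<close>

fun pick :: "bool \<Rightarrow> 'b \<Rightarrow> 'b \<Rightarrow> 'b" where
  "pick True x y = x"
| "pick False x y = y"

primrec nbs :: "table \<Rightarrow> char \<Rightarrow> string" where
  "nbs [] a = []"
| "nbs (e # E) a = pick (fst e = a) (snd e) (nbs E a)"

primrec link :: "char \<Rightarrow> char \<Rightarrow> table \<Rightarrow> table" where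
  "link a b [] = [(a, [b])]"
| "link a b (e # E) = pick (fst e = a) ((a, b # snd e) # E) (e # link a b E)"

definition connect :: "char \<Rightarrow> char \<Rightarrow> table \<Rightarrow> table" where
  "connect a b E = link a b (link b a E)"

fun trail :: "table \<Rightarrow> string \<Rightarrow> bool" where
  "trail E (a # b # p) \<longleftrightarrow> b \<in> set (nbs E a) \<and> trail E (b # p)"
| "trail E _ \<longleftrightarrow> True"

fun connect_along :: "string \<Rightarrow> table \<Rightarrow> table" where
  "connect_along (a # b # p) E = connect a b (connect_along (b # p) E)"
| "connect_along _ E = E"

definition table_of :: "string list \<Rightarrow> table" where
  "table_of W = foldr connect_along W []"

text \<open>Records that the new vertex \<open>n\<close> is not adjacent to the vertices in \<open>C\<close>, whose neighbours have all
been named before.\<close>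

definition seal :: "char \<Rightarrow> string \<Rightarrow> table \<Rightarrow> table" where
  "seal n C X = foldr (\<lambda>z. connect z n) C X"

text \<open>The substitution that replaces the letters of the first word by those of the second one, used to find
a copy of one configuration inside another.\<close>

fun rename :: "string \<Rightarrow> string \<Rightarrow> char \<Rightarrow> char" where
  "rename (v # vs) (m # ms) c = (if c = v then m else rename vs ms c)"
| "rename _ _ c = c"

text \<open>The path that is being followed. \<open>Walk x y r used cand fresh\<close> stands for the knowledge that there is a
path of length \<open>r\<close> from \<open>x\<close> to \<open>y\<close> that avoids the vertices \<open>used\<close> and whose second vertex is in \<open>cand\<close>
or, if \<open>fresh\<close> holds, has no name yet.\<close>

datatype pending = Idle | Walk char char nat string string bool

definition walk :: "char \<Rightarrow> char \<Rightarrow> nat \<Rightarrow> string \<Rightarrow> string \<Rightarrow> pending" where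
  "walk x y r used V =
     (if r = 1 then Walk x y r used [y] False
      else Walk x y r used (filter (\<lambda>z. z \<noteq> x \<and> z \<noteq> y \<and> z \<notin> set used) V) True)"

definition embeds :: "string \<Rightarrow> table \<Rightarrow> table \<Rightarrow> string \<Rightarrow> config \<Rightarrow> bool" where
  "embeds V E X m cfg \<longleftrightarrow> (case cfg of (vs, W, N) \<Rightarrow>
     length m = length vs \<and> distinct m \<and> set m \<subseteq> set V
     \<and> (\<forall>w\<in>set W. trail E (map (rename vs m) w)) \<and> (\<forall>w\<in>set N. trail X (map (rename vs m) w)))"

text \<open>A state of the case analysis: the named vertices, the known edges and non-edges, the closed vertices
(those all of whose neighbours are named) and the path that is being followed.\<close>

type_synonym state = "string \<times> table \<times> table \<times> string \<times> pending"

text \<open>The first three instructions end a case: two paths of length eight with common ends, a nine-cycle, a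
copy of an excluded configuration (given by its index and the images of its vertices). \<open>Split a b\<close>
distinguishes whether \<open>a\<close> and \<open>b\<close> are adjacent. \<open>Close x n\<close> distinguishes whether \<open>x\<close> has a neighbour
without name, called \<open>n\<close> from then on, or is closed. \<open>Join a b\<close> begins to follow the path of length
eight between two non-adjacent vertices. \<open>Next z\<close> distinguishes whether the second vertex of the
path is \<open>z\<close> (and walks on from there) or not; if \<open>z\<close> is a new name it stands for a vertex without
name. \<open>Flip\<close> continues at the other end of the path and \<open>Dead\<close> ends the case when no second vertex is
left.\<close>

datatype instr =
    Two string string
  | Nine string
  | Known nat string
  | Split char char
  | Close char char
  | Join char char
  | Next char
  | Flip
  | Dead

fun step :: "config list \<Rightarrow> state \<Rightarrow> instr \<Rightarrow> state list option" where
  "step K (V, E, X, C, g) (Two p q) =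
     (if length p = 9 \<and> length q = 9 \<and> hd p = hd q \<and> last p = last q \<and> p \<noteq> q
        \<and> distinct p \<and> distinct q \<and> trail E p \<and> trail E q then Some [] else None)"
| "step K (V, E, X, C, g) (Nine p) =
     (if length p = 9 \<and> distinct p \<and> trail E p \<and> hd p \<in> set (nbs E (last p)) then Some [] else None)"
| "step K (V, E, X, C, g) (Known k m) =
     (if k < length K \<and> embeds V E X m (K ! k) then Some [] else None)"
| "step K (V, E, X, C, g) (Split a b) =
     (if a \<in> set V \<and> b \<in> set V
      then Some [(V, connect a b E, X, C, g), (V, E, connect a b X, C, g)] else None)"
| "step K (V, E, X, C, g) (Close x n) =
     (if x \<in> set V \<and> n \<notin> set V
      then Some [(n # V, connect x n E, seal n C X, C, Idle), (V, E, X, x # C, g)] else None)"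
| "step K (V, E, X, C, g) (Join a b) =
     (if a \<noteq> b \<and> b \<in> set (nbs X a) then Some [(V, E, X, C, walk a b 8 [] V)] else None)"
| "step K (V, E, X, C, Walk x y r used cand fresh) (Next z) =
     (if z \<in> set V
      then Some [(V, connect x z E, X, C, if r = 1 then Idle else walk z y (r - 1) (x # used) V),
                 (V, E, X, C, Walk x y r used (filter (\<lambda>u. u \<noteq> z) cand) fresh)]
      else if r \<noteq> 1
      then Some [(z # V, connect x z E, seal z C X, C, walk z y (r - 1) (x # used) (z # V)),
                 (V, E, X, C, Walk x y r used cand False)]
      else None)"
| "step K (V, E, X, C, Walk x y r used cand fresh) Flip = Some [(V, E, X, C, walk y x r used V)]"
| "step K (V, E, X, C, Walk x y r used cand fresh) Dead =
     (if (\<forall>z\<in>set cand. z \<in> set (nbs X x)) \<and> (fresh \<longrightarrow> x \<in> set C) then Some [] else None)"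
| "step K s i = None"

text \<open>A certificate lists its instructions in depth-first order, so the open cases form a stack. It is
complete if it ends with the empty stack.\<close>

fun push :: "state list option \<Rightarrow> state list \<Rightarrow> state list option" where
  "push (Some new) ss = Some (new @ ss)"
| "push None ss = None"

fun advance :: "config list \<Rightarrow> state list option \<Rightarrow> instr \<Rightarrow> state list option" where
  "advance K (Some (s # ss)) i = push (step K s i) ss"
| "advance K _ i = None"

primrec run :: "config list \<Rightarrow> state list option \<Rightarrow> instr list \<Rightarrow> bool" where
  "run K ss [] \<longleftrightarrow> ss = Some []"
| "run K ss (i # is) \<longleftrightarrow> run K (advance K ss i) is"

definition words :: "string \<Rightarrow> string list" where
  "words s = foldr (\<lambda>c ws. if c = CHR '' '' then [] # ws else (c # hd ws) # tl ws) s [[]]"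

text \<open>In writing, an instruction is one letter followed by its vertices; a digit followed by vertices is
\<open>Known\<close>. Soundness does not depend on this notation: whatever a malformed word is decoded to, it is an
instruction that has to pass \<open>step\<close>.\<close>

definition decode :: "string \<Rightarrow> instr" where
  "decode s = (let c = hd s; w = tl s in
     if c = CHR ''S'' then Split (hd w) (hd (tl w))
     else if c = CHR ''X'' then Next (hd w)
     else if c = CHR ''D'' then Dead
     else if c = CHR ''T'' then Two (take 9 w) (drop 9 w)
     else if c = CHR ''N'' then Nine w
     else if c = CHR ''F'' then Flip
     else if c = CHR ''C'' then Close (hd w) (hd (tl w))
     else if c = CHR ''J'' then Join (hd w) (hd (tl w))
     else Known (length (takeWhile (\<lambda>d. d \<noteq> c) ''0123456789'')) w)"

definition refutes :: "config list \<Rightarrow> config \<Rightarrow> string list \<Rightarrow> bool" where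
  "refutes K cfg ls \<longleftrightarrow> (case cfg of (vs, W, N) \<Rightarrow>
     (\<forall>w\<in>set W. set w \<subseteq> set vs) \<and> (\<forall>w\<in>set N. set w \<subseteq> set vs)
     \<and> run K (Some [(vs, table_of W, table_of N, [], Idle)]) (map decode (concat (map words ls))))"

section \<open>Soundness of refutations\<close>

lemma pick_if: "pick b x y = (if b then x else y)"
  by (cases b) auto

lemma nbs_link: "set (nbs (link a b E) c) = (if c = a then insert b (set (nbs E c)) else set (nbs E c))"
proof (induction E)
  case (Cons e E)
  then show ?case by (cases "fst e = a"; cases "c = a"; simp add: pick_if)
qed simp

lemma nbs_connect:
  "y \<in> set (nbs (connect a b E) x) \<longleftrightarrow> x = a \<and> y = b \<or> x = b \<and> y = a \<or> y \<in> set (nbs E x)"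
  by (auto simp: connect_def nbs_link)

lemma nbs_seal:
  "y \<in> set (nbs (seal n C X) x) \<longleftrightarrow> x \<in> set C \<and> y = n \<or> x = n \<and> y \<in> set C \<or> y \<in> set (nbs X x)"
proof (induction C)
  case (Cons c C)
  have "seal n (c # C) X = connect c n (seal n C X)" by (simp add: seal_def)
  then show ?case unfolding nbs_connect Cons by (simp only: nbs_connect Cons list.set) blast
qed (simp add: seal_def)

lemma nbs_connect_along:
  "y \<in> set (nbs (connect_along w E) x) \<longleftrightarrow>
     (x, y) \<in> set (zip w (tl w)) \<or> (y, x) \<in> set (zip w (tl w)) \<or> y \<in> set (nbs E x)"
  by (induction w E rule: connect_along.induct) (auto simp: nbs_connect)

lemma nbs_table_of:
  "y \<in> set (nbs (table_of W) x) \<longleftrightarrow>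
     (\<exists>w\<in>set W. (x, y) \<in> set (zip w (tl w)) \<or> (y, x) \<in> set (zip w (tl w)))"
  by (induction W) (auto simp: table_of_def nbs_connect_along)

lemma successively_zip: "successively P w \<longleftrightarrow> (\<forall>(a, b)\<in>set (zip w (tl w)). P a b)"
  by (induction P w rule: successively.induct) auto

lemma trail_iff: "trail E p \<longleftrightarrow> successively (\<lambda>a b. b \<in> set (nbs E a)) p"
  by (induction E p rule: trail.induct) auto

lemma rename_in: "length ms = length vs \<Longrightarrow> c \<in> set vs \<Longrightarrow> rename vs ms c \<in> set ms"
  by (induction vs ms c rule: rename.induct) auto

lemma inj_on_rename: "length ms = length vs \<Longrightarrow> distinct ms \<Longrightarrow> inj_on (rename vs ms) (set vs)"
proof (induction vs ms rule: list_induct2')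
  case (4 v vs m ms)
  have "m \<noteq> rename vs ms c" if "c \<in> set vs" for c
    using rename_in[of ms vs c] that 4 by auto
  then show ?case using 4 by (force simp: inj_on_def)
qed auto

context unique_eight_paths
begin

definition realizes :: "(char \<Rightarrow> 'a) \<Rightarrow> config \<Rightarrow> bool" where
  "realizes f cfg \<longleftrightarrow> (case cfg of (vs, W, N) \<Rightarrow>
     inj_on f (set vs) \<and> f ` set vs \<subseteq> verts
     \<and> (\<forall>w\<in>set W. successively (\<lambda>a b. adj (f a) (f b)) w)
     \<and> (\<forall>w\<in>set N. successively (\<lambda>a b. \<not> adj (f a) (f b)) w))"

definition forbidden :: "config \<Rightarrow> bool" where
  "forbidden cfg \<longleftrightarrow> (\<nexists>f. realizes f cfg)"

text \<open>The naming \<open>f\<close> satisfies all that is recorded in a state, except for the path that is being followed.\<close>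

definition model :: "(char \<Rightarrow> 'a) \<Rightarrow> string \<Rightarrow> table \<Rightarrow> table \<Rightarrow> string \<Rightarrow> bool" where
  "model f V E X C \<longleftrightarrow> inj_on f (set V) \<and> f ` set V \<subseteq> verts
     \<and> (\<forall>a b. b \<in> set (nbs E a) \<longrightarrow> a \<in> set V \<and> b \<in> set V \<and> adj (f a) (f b))
     \<and> (\<forall>a b. b \<in> set (nbs X a) \<longrightarrow> a \<in> set V \<and> b \<in> set V \<and> \<not> adj (f a) (f b))
     \<and> (\<forall>a\<in>set C. a \<in> set V \<and> (\<forall>y. adj (f a) y \<longrightarrow> y \<in> f ` set V))"

definition joins :: "'a list \<Rightarrow> nat \<Rightarrow> 'a \<Rightarrow> 'a \<Rightarrow> bool" where
  "joins p r x y \<longleftrightarrow> simple_path adj p \<and> length p = Suc r \<and> hd p = x \<and> last p = y"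

fun pends :: "(char \<Rightarrow> 'a) \<Rightarrow> string \<Rightarrow> pending \<Rightarrow> bool" where
  "pends f V Idle \<longleftrightarrow> True"
| "pends f V (Walk x y r used cand fresh) \<longleftrightarrow> r \<noteq> 0 \<and> x \<in> set V \<and> y \<in> set V \<and> set used \<subseteq> set V \<and>
     (\<exists>p. joins p r (f x) (f y) \<and> set p \<inter> f ` set used = {}
        \<and> (p ! 1 \<in> f ` set cand \<or> fresh \<and> p ! 1 \<notin> f ` set V))"

lemma adj_verts2: "adj x y \<Longrightarrow> y \<in> verts"
  using adj_sym adj_verts by blast

lemma model_connect:
  "model f V E X C \<Longrightarrow> a \<in> set V \<Longrightarrow> b \<in> set V \<Longrightarrow> adj (f a) (f b) \<Longrightarrow> model f V (connect a b E) X C"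
  unfolding model_def nbs_connect using adj_sym by blast

lemma model_disconnect:
  "model f V E X C \<Longrightarrow> a \<in> set V \<Longrightarrow> b \<in> set V \<Longrightarrow> \<not> adj (f a) (f b) \<Longrightarrow> model f V E (connect a b X) C"
  unfolding model_def nbs_connect using adj_sym by blast

text \<open>A vertex \<open>w\<close> without name cannot be adjacent to a closed vertex; this justifies \<open>seal\<close>.\<close>

lemma model_extend:
  assumes M: "model f V E X C" and x: "x \<in> set V" and n: "n \<notin> set V" and w: "adj (f x) w" "w \<notin> f ` set V"
  shows "model (f(n := w)) (n # V) (connect x n E) (seal n C X) C"
proof -
  have eq: "(f(n := w)) a = f a" if "a \<in> set V" for a using that n by auto
  have img: "(f(n := w)) ` set (n # V) = insert w (f ` set V)" using n by auto
  have closed: "\<not> adj (f a) w" "\<not> adj w (f a)" if "a \<in> set C" for a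
    using M w that adj_sym unfolding model_def by blast+
  have "inj_on f (set V)" using M unfolding model_def by blast
  then have "inj_on (f(n := w)) (set (n # V))"
    using n w(2) by (auto simp: inj_on_def)
  moreover have "insert w (f ` set V) \<subseteq> verts"
    using M w(1) adj_verts2 unfolding model_def by auto
  moreover have "a \<in> set (n # V) \<and> b \<in> set (n # V) \<and> adj ((f(n := w)) a) ((f(n := w)) b)"
    if "b \<in> set (nbs (connect x n E) a)" for a b
  proof -
    have E: "a \<in> set V \<and> b \<in> set V \<and> adj (f a) (f b)" if "b \<in> set (nbs E a)"
      using M that unfolding model_def by blast
    from that show ?thesis
      unfolding nbs_connect using E x eq w(1) adj_sym[OF w(1)] by (elim disjE conjE) simp_all
  qed
  moreover have "a \<in> set (n # V) \<and> b \<in> set (n # V) \<and> \<not> adj ((f(n := w)) a) ((f(n := w)) b)"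
    if "b \<in> set (nbs (seal n C X) a)" for a b
  proof -
    have C: "set C \<subseteq> set V" using M unfolding model_def by blast
    from that show ?thesis unfolding nbs_seal
    proof (elim disjE conjE)
      assume "a \<in> set C" "b = n"
      then show ?thesis using C closed n by auto
    next
      assume "a = n" "b \<in> set C"
      then show ?thesis using C closed n by auto
    next
      assume "b \<in> set (nbs X a)"
      then have "a \<in> set V \<and> b \<in> set V \<and> \<not> adj (f a) (f b)" using M unfolding model_def by blast
      then show ?thesis using eq by simp
    qed
  qed
  moreover have "a \<in> set (n # V) \<and> (\<forall>y. adj ((f(n := w)) a) y \<longrightarrow> y \<in> insert w (f ` set V))" if "a \<in> set C" for a
  proof -
    have "a \<in> set V" "\<And>y. adj (f a) y \<Longrightarrow> y \<in> f ` set V" using M that unfolding model_def by blast+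
    then show ?thesis using eq by simp
  qed
  ultimately show ?thesis unfolding model_def img by blast
qed

text \<open>By distinctness, the second vertex of a path of length at least two is neither of the two ends, so
among the named vertices it is one of the candidates listed by \<open>walk\<close>; if the length is one, it is the
last vertex.\<close>

lemma pends_walk:
  assumes "r \<noteq> 0" "inj_on f (set V)" "x \<in> set V" "y \<in> set V" "set used \<subseteq> set V"
    and p: "joins p r (f x) (f y)" "set p \<inter> f ` set used = {}"
  shows "pends f V (walk x y r used V)"
proof (cases "r = 1")
  case True
  have "length p = 2" using p True by (auto simp: joins_def)
  then have "p ! 1 = last p" by (auto simp: length_Suc_conv numeral_2_eq_2)
  then have "p ! 1 \<in> f ` set [y]" using p by (simp add: joins_def)
  then have "p ! 1 \<in> f ` set [y] \<or> False \<and> p ! 1 \<notin> f ` set V" by blast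
  then show ?thesis using assms True unfolding walk_def by (auto intro!: exI[of _ p])
next
  case False
  have len: "length p = Suc r" "r \<ge> 2" and dp: "distinct p" and hl: "hd p = f x" "last p = f y"
    using p False assms(1) by (auto simp: joins_def simple_path_def)
  have ne: "p \<noteq> []" using len by auto
  have "p ! 1 \<noteq> p ! 0" "p ! 1 \<noteq> p ! r"
    using nth_eq_iff_index_eq[OF dp] len by auto
  then have 1: "p ! 1 \<noteq> f x" "p ! 1 \<noteq> f y"
    using hl ne len by (auto simp: hd_conv_nth last_conv_nth)
  have "p ! 1 \<in> set p" using len by simp
  then have 2: "p ! 1 \<notin> f ` set used" using p(2) by blast
  have "p ! 1 \<in> f ` set (filter (\<lambda>z. z \<noteq> x \<and> z \<noteq> y \<and> z \<notin> set used) V)" if "p ! 1 \<in> f ` set V"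
    using that 1 2 by auto
  then show ?thesis using assms False unfolding walk_def by (auto intro!: exI[of _ p])
qed

lemma simple_path_if_trail:
  assumes "model f V E X C" "length p = 9" "distinct p" "trail E p"
  shows "simple_path adj (map f p)" "set p \<subseteq> set V"
proof -
  have E: "a \<in> set V \<and> b \<in> set V \<and> adj (f a) (f b)" if "b \<in> set (nbs E a)" for a b
    using assms(1) that unfolding model_def by blast
  have "set p \<subseteq> set V" if "trail E p" "length p \<noteq> 1" for p
    using that
  proof (induction p rule: induct_list012)
    case (3 a b p)
    then have "b \<in> set (nbs E a)" by simp
    from E[OF this] 3 show ?case by (cases p) auto
  qed auto
  then show V: "set p \<subseteq> set V" using assms by auto
  have "successively (\<lambda>a b. adj (f a) (f b)) p"
    using assms(4) E unfolding trail_iff by (auto elim: successively_mono)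
  moreover have "distinct (map f p)"
    using assms V unfolding model_def by (auto simp: distinct_map intro: inj_on_subset)
  ultimately show "simple_path adj (map f p)"
    by (simp add: simple_path_def successively_map)
qed

lemma joins_rev: "joins p r x y \<Longrightarrow> joins (rev p) r y x"
  using adj_sym
  by (auto simp: joins_def simple_path_def hd_rev last_rev elim!: successively_mono)

lemma joins_Cons:
  assumes "joins p r x y" "r \<noteq> 0"
  shows "\<exists>q. p = x # q \<and> joins q (r - 1) (p ! 1) y \<and> x \<notin> set q \<and> adj x (p ! 1)"
proof -
  obtain z q where p: "p = x # z # q"
    using assms unfolding joins_def by (cases p; cases "tl p") auto
  then show ?thesis
    using assms by (auto simp: joins_def simple_path_def)
qed

definition refuted :: "state \<Rightarrow> bool" where
  "refuted s \<longleftrightarrow> (case s of (V, E, X, C, g) \<Rightarrow> \<forall>f. model f V E X C \<longrightarrow> \<not> pends f V g)"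

lemma refutedD: "refuted (V, E, X, C, g) \<Longrightarrow> model f V E X C \<Longrightarrow> pends f V g \<Longrightarrow> False"
  by (simp add: refuted_def)

text \<open>An instruction makes an exhaustive distinction of cases: a naming that satisfies the given state,
possibly extended by a name for one more vertex, satisfies one of the new states.\<close>

lemma step_sound:
  assumes K: "\<forall>k\<in>set K. forbidden k"
    and step: "step K (V, E, X, C, g) i = Some ss" and ss: "\<forall>s\<in>set ss. refuted s"
    and M: "model f V E X C" and P: "pends f V g"
  shows False
proof -
  have inj: "inj_on f (set V)" and fV: "f ` set V \<subseteq> verts"
    using M unfolding model_def by blast+
  show ?thesis
  proof (cases i)
    case (Two p q)
    then have pq: "length p = 9" "length q = 9" "hd p = hd q" "last p = last q" "p \<noteq> q"
      "distinct p" "distinct q" "trail E p" "trail E q"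
      using step by (auto split: if_splits)
    then have "simple_path adj (map f p)" "simple_path adj (map f q)" and V: "set p \<union> set q \<subseteq> set V"
      using simple_path_if_trail[OF M, of p] simple_path_if_trail[OF M, of q] by auto
    moreover have "p \<noteq> []" "q \<noteq> []" using pq by auto
    then have "hd (map f p) = hd (map f q)" "last (map f p) = last (map f q)"
      using pq by (simp_all add: hd_map last_map)
    ultimately have "map f p = map f q"
      using pq unique_path by auto
    then show False
      using pq(5) V inj by (auto dest: map_inj_on[OF _ inj_on_subset])
  next
    case (Nine p)
    then have p: "length p = 9" "distinct p" "trail E p" "hd p \<in> set (nbs E (last p))"
      using step by (auto split: if_splits)
    then have "simple_path adj (map f p)" "adj (f (last p)) (f (hd p))" "p \<noteq> []"
      using simple_path_if_trail[OF M, of p] M unfolding model_def by auto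
    then show False
      using no_nine_cycle[of "map f p"] p(1) by (auto simp: hd_map last_map)
  next
    case (Known k m)
    obtain vs W N where k: "K ! k = (vs, W, N)" by (cases "K ! k")
    let ?g = "rename vs m"
    have k': "k < length K" "embeds V E X m (vs, W, N)"
      using Known step k by (auto split: if_splits)
    then have m: "length m = length vs" "distinct m" "set m \<subseteq> set V"
      and W: "\<And>w. w \<in> set W \<Longrightarrow> trail E (map ?g w)" and N: "\<And>w. w \<in> set N \<Longrightarrow> trail X (map ?g w)"
      by (auto simp: embeds_def)
    have img: "?g ` set vs \<subseteq> set V" using m rename_in by blast
    have "inj_on (f \<circ> ?g) (set vs)"
      using img inj inj_on_rename[OF m(1,2)] by (blast intro: comp_inj_on inj_on_subset)
    moreover have "(f \<circ> ?g) ` set vs \<subseteq> verts"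
      using fV img by fastforce
    moreover have "successively (\<lambda>a b. adj (f (?g a)) (f (?g b))) w" if "w \<in> set W" for w
      using W[OF that] M unfolding trail_iff successively_map model_def
      by (auto elim!: successively_mono)
    moreover have "successively (\<lambda>a b. \<not> adj (f (?g a)) (f (?g b))) w" if "w \<in> set N" for w
      using N[OF that] M unfolding trail_iff successively_map model_def
      by (auto elim!: successively_mono)
    ultimately have "realizes (f \<circ> ?g) (K ! k)"
      unfolding k realizes_def by auto
    moreover have "K ! k \<in> set K" using k'(1) by simp
    ultimately show False using K unfolding forbidden_def by blast
  next
    case (Split a b)
    then have ab: "a \<in> set V" "b \<in> set V"
      and ss': "refuted (V, connect a b E, X, C, g)" "refuted (V, E, connect a b X, C, g)"
      using step ss by (auto split: if_splits)
    show False
    proof (cases "adj (f a) (f b)")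
      case True
      from refutedD[OF ss'(1) model_connect[OF M ab this] P] show False .
    next
      case False
      from refutedD[OF ss'(2) model_disconnect[OF M ab this] P] show False .
    qed
  next
    case (Close x n)
    then have x: "x \<in> set V" "n \<notin> set V"
      and ss': "refuted (n # V, connect x n E, seal n C X, C, Idle)" "refuted (V, E, X, x # C, g)"
      using step ss by (auto split: if_splits)
    show False
    proof (cases "\<exists>w. adj (f x) w \<and> w \<notin> f ` set V")
      case True
      then obtain w where "adj (f x) w" "w \<notin> f ` set V" by blast
      from refutedD[OF ss'(1) model_extend[OF M x this]] show False by simp
    next
      case False
      then have "model f V E X (x # C)" using M x unfolding model_def by auto
      from refutedD[OF ss'(2) this P] show False .
    qed
  next
    case (Join a b)
    then have ab: "a \<noteq> b" "b \<in> set (nbs X a)" and ss': "refuted (V, E, X, C, walk a b 8 [] V)"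
      using step ss by (auto split: if_splits)
    then have V: "a \<in> set V" "b \<in> set V" "\<not> adj (f a) (f b)"
      using M unfolding model_def by blast+
    moreover have "f a \<noteq> f b" using inj_onD[OF inj] V ab(1) by blast
    ultimately obtain p where "joins p 8 (f a) (f b)"
      using ex_path[of "f a" "f b"] fV unfolding joins_def by auto
    then have "pends f V (walk a b 8 [] V)"
      using V inj by (intro pends_walk[of _ _ _ _ _ _ p]) auto
    from refutedD[OF ss' M this] show False .
  next
    case (Next z)
    obtain x y r used cand fresh where g: "g = Walk x y r used cand fresh"
      using step Next by (cases g) auto
    from P g obtain p where p: "joins p r (f x) (f y)" "set p \<inter> f ` set used = {}"
      and p1: "p ! 1 \<in> f ` set cand \<or> fresh \<and> p ! 1 \<notin> f ` set V"
      and r: "r \<noteq> 0" and V: "x \<in> set V" "y \<in> set V" "set used \<subseteq> set V" by auto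
    obtain q where q: "p = f x # q" "joins q (r - 1) (p ! 1) (f y)" "f x \<notin> set q" "adj (f x) (p ! 1)"
      using joins_Cons[OF p(1) r] by blast
    then have q': "set q \<inter> f ` set (x # used) = {}" using p(2) by auto
    show False
    proof (cases "z \<in> set V")
      case True
      then have ss': "refuted (V, connect x z E, X, C, if r = 1 then Idle else walk z y (r - 1) (x # used) V)"
        "refuted (V, E, X, C, Walk x y r used (filter (\<lambda>u. u \<noteq> z) cand) fresh)"
        using step ss Next g by auto
      show False
      proof (cases "p ! 1 = f z")
        case p1z: True
        have "model f V (connect x z E) X C" using model_connect[OF M V(1) True] q(4) p1z by simp
        moreover have "pends f V (if r = 1 then Idle else walk z y (r - 1) (x # used) V)"
          using pends_walk[OF _ inj True V(2), of "r - 1" "x # used" q] q(2) q' V r p1z by auto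
        ultimately show False using refutedD[OF ss'(1)] by blast
      next
        case False
        then have "p ! 1 \<in> f ` set (filter (\<lambda>u. u \<noteq> z) cand) \<or> fresh \<and> p ! 1 \<notin> f ` set V"
          using p1 by auto
        then have "pends f V (Walk x y r used (filter (\<lambda>u. u \<noteq> z) cand) fresh)"
          using p r V by auto
        from refutedD[OF ss'(2) M this] show False .
      qed
    next
      case False
      then have r1: "r \<noteq> 1"
        and ss': "refuted (z # V, connect x z E, seal z C X, C, walk z y (r - 1) (x # used) (z # V))"
          "refuted (V, E, X, C, Walk x y r used cand False)"
        using step ss Next g by (auto split: if_splits)
      show False
      proof (cases "p ! 1 \<in> f ` set V")
        case True
        then have "pends f V (Walk x y r used cand False)" using p p1 r V by auto
        from refutedD[OF ss'(2) M this] show False .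
      next
        case new: False
        let ?f = "f(z := p ! 1)"
        have eq: "?f a = f a" if "a \<in> set V" for a using that False by auto
        have M': "model ?f (z # V) (connect x z E) (seal z C X) C"
          using model_extend[OF M V(1) False q(4) new] .
        then have "inj_on ?f (set (z # V))" unfolding model_def by blast
        moreover have "?f ` set (x # used) = f ` set (x # used)"
          using V by (intro image_cong refl eq) auto
        ultimately have "pends ?f (z # V) (walk z y (r - 1) (x # used) (z # V))"
          using r r1 V q(2) q' eq[OF V(2)]
          by (intro pends_walk[of _ _ _ _ _ _ q]) auto
        from refutedD[OF ss'(1) M' this] show False .
      qed
    qed
  next
    case Flip
    obtain x y r used cand fresh where g: "g = Walk x y r used cand fresh"
      using step Flip by (cases g) auto
    from P g obtain p where p: "joins p r (f x) (f y)" "set p \<inter> f ` set used = {}"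
      and r: "r \<noteq> 0" and V: "x \<in> set V" "y \<in> set V" "set used \<subseteq> set V" by auto
    have "pends f V (walk y x r used V)"
      using pends_walk[OF r inj V(2,1,3) joins_rev[OF p(1)]] p(2) by simp
    moreover have "refuted (V, E, X, C, walk y x r used V)" using step ss Flip g by auto
    ultimately show False using refutedD M by blast
  next
    case Dead
    obtain x y r used cand fresh where g: "g = Walk x y r used cand fresh"
      using step Dead by (cases g) auto
    from P g obtain p where p: "joins p r (f x) (f y)"
      and p1: "p ! 1 \<in> f ` set cand \<or> fresh \<and> p ! 1 \<notin> f ` set V" and r: "r \<noteq> 0" by auto
    have "\<forall>z\<in>set cand. z \<in> set (nbs X x)" "fresh \<longrightarrow> x \<in> set C"
      using step Dead g by (auto split: if_splits)
    moreover have "adj (f x) (p ! 1)" using joins_Cons[OF p r] by blast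
    ultimately show False using p1 M unfolding model_def by auto
  qed
qed

lemma run_sound:
  assumes K: "\<forall>k\<in>set K. forbidden k"
  shows "run K (Some ss) is \<Longrightarrow> s \<in> set ss \<Longrightarrow> refuted s"
proof (induction "is" arbitrary: ss s)
  case (Cons i "is")
  have "\<not> run K None is" for "is" by (induction "is") auto
  then obtain s' rest new where ss: "ss = s' # rest" and new: "step K s' i = Some new"
    and "run K (Some (new @ rest)) is"
    using Cons.prems(1) by (cases "(K, Some ss, i)" rule: advance.cases; cases "step K (hd ss) i") auto
  then have *: "refuted t" if "t \<in> set (new @ rest)" for t
    using Cons.IH that by blast
  show ?case
  proof (cases "s = s'")
    case True
    obtain V E X C g where s': "s' = (V, E, X, C, g)" by (cases s')
    have "\<forall>t\<in>set new. refuted t" using * by simp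
    then have False if "model f V E X C" "pends f V g" for f
      using step_sound[OF K new[unfolded s'] _ that] by simp
    then show ?thesis unfolding True s' refuted_def by auto
  next
    case False
    then show ?thesis using * ss Cons.prems(2) by auto
  qed
qed simp

theorem forbidden_if_refutes:
  assumes "refutes K cfg c" "\<forall>k\<in>set K. forbidden k"
  shows "forbidden cfg"
  unfolding forbidden_def
proof
  assume "\<exists>f. realizes f cfg"
  then obtain f where f: "realizes f cfg" by blast
  obtain vs W N where cfg: "cfg = (vs, W, N)" by (cases cfg)
  have sub: "\<And>w. w \<in> set W \<union> set N \<Longrightarrow> set w \<subseteq> set vs"
    and c: "run K (Some [(vs, table_of W, table_of N, [], Idle)]) (map decode (concat (map words c)))"
    using assms(1) cfg by (auto simp: refutes_def)
  have in_vs: "a \<in> set vs \<and> b \<in> set vs" if "w \<in> set W \<union> set N" "(a, b) \<in> set (zip w (tl w))" for w a b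
  proof -
    have "a \<in> set w" "b \<in> set (tl w)"
      using that(2) by (auto dest: set_zip_leftD set_zip_rightD)
    then show ?thesis using sub[OF that(1)] by (cases w) auto
  qed
  have W: "adj (f a) (f b)" if "w \<in> set W" "(a, b) \<in> set (zip w (tl w))" for w a b
    using f that unfolding realizes_def cfg successively_zip by auto
  have N: "\<not> adj (f a) (f b)" if "w \<in> set N" "(a, b) \<in> set (zip w (tl w))" for w a b
    using f that unfolding realizes_def cfg successively_zip by auto
  have E: "a \<in> set vs \<and> b \<in> set vs \<and> adj (f a) (f b)" if b: "b \<in> set (nbs (table_of W) a)" for a b
  proof -
    obtain w where "w \<in> set W" "(a, b) \<in> set (zip w (tl w)) \<or> (b, a) \<in> set (zip w (tl w))"
      using b unfolding nbs_table_of by blast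
    then show ?thesis using W in_vs adj_sym by blast
  qed
  have X: "a \<in> set vs \<and> b \<in> set vs \<and> \<not> adj (f a) (f b)" if b: "b \<in> set (nbs (table_of N) a)" for a b
  proof -
    obtain w where "w \<in> set N" "(a, b) \<in> set (zip w (tl w)) \<or> (b, a) \<in> set (zip w (tl w))"
      using b unfolding nbs_table_of by blast
    then show ?thesis using N in_vs adj_sym by blast
  qed
  have "inj_on f (set vs)" "f ` set vs \<subseteq> verts"
    using f unfolding realizes_def cfg by auto
  then have "model f vs (table_of W) (table_of N) []"
    unfolding model_def using E X by simp
  then show False
    using run_sound[OF assms(2) c, of "(vs, table_of W, table_of N, [], Idle)"] refutedD by fastforce
qed

end

section \<open>Cliques\<close>

definition pairs :: "string \<Rightarrow> string list" where
  "pairs vs = concat (map (\<lambda>a. map (\<lambda>b. [a, b]) (filter (\<lambda>b. b \<noteq> a) vs)) vs)"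

definition clique :: "string \<Rightarrow> config" where
  "clique vs = (vs, pairs vs, [])"

text \<open>The ear, a path with inner vertices \<open>us\<close>, is attached to the first two vertices of the clique. Its length is
one more than the number of its inner vertices.\<close>

definition clique_with_ear :: "string \<Rightarrow> string \<Rightarrow> config" where
  "clique_with_ear vs us = (vs @ us, (hd vs # us @ [vs ! 1]) # pairs vs, [])"

text \<open>The first letter is the pendant vertex, the second one its only neighbour in the clique formed by all
letters but the first.\<close>

definition pendant_clique :: "string \<Rightarrow> config" where
  "pendant_clique vs = (vs, take 2 vs # pairs (tl vs), map (\<lambda>y. [hd vs, y]) (drop 2 vs))"

definition diamond :: config where
  "diamond = (''abcd'', [''abcda'', ''ac''], [''bd''])"

lemma in_pairs: "w \<in> set (pairs vs) \<longleftrightarrow> (\<exists>a\<in>set vs. \<exists>b\<in>set vs. a \<noteq> b \<and> w = [a, b])"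
  by (auto simp: pairs_def)

context unique_eight_paths
begin

definition is_clique :: "'a set \<Rightarrow> bool" where
  "is_clique Q \<longleftrightarrow> Q \<subseteq> verts \<and> (\<forall>x\<in>Q. \<forall>y\<in>Q. x \<noteq> y \<longrightarrow> adj x y)"

lemma not_clique_if_forbidden:
  assumes "forbidden (clique vs)" "distinct vs" "is_clique Q" "finite Q"
  shows "card Q \<noteq> length vs"
proof
  assume "card Q = length vs"
  then have "card (set vs) = card Q" using assms(2) by (simp add: distinct_card)
  then obtain f where f: "bij_betw f (set vs) Q"
    using assms(4) finite_same_card_bij[of "set vs" Q] by auto
  then have inj: "inj_on f (set vs)" and img: "f ` set vs = Q" unfolding bij_betw_def by auto
  have "adj (f a) (f b)" if "a \<in> set vs" "b \<in> set vs" "a \<noteq> b" for a b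
  proof -
    have "f a \<noteq> f b" using inj that by (auto dest: inj_onD)
    then show ?thesis using that assms(3) img unfolding is_clique_def by blast
  qed
  then have "successively (\<lambda>a b. adj (f a) (f b)) w" if "w \<in> set (pairs vs)" for w
    using that by (auto simp: in_pairs)
  then have "realizes f (clique vs)"
    using inj img assms(3) unfolding realizes_def clique_def is_clique_def by simp
  then show False using assms(1) unfolding forbidden_def by blast
qed

lemma forbidden_cliqueI:
  assumes "\<And>Q. is_clique Q \<Longrightarrow> finite Q \<Longrightarrow> card Q \<noteq> length vs" "distinct vs"
  shows "forbidden (clique vs)"
  unfolding forbidden_def
proof
  assume "\<exists>f. realizes f (clique vs)"
  then obtain f where "realizes f (clique vs)" by blast
  then have f: "inj_on f (set vs)" "f ` set vs \<subseteq> verts"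
    and W: "\<And>w. w \<in> set (pairs vs) \<Longrightarrow> successively (\<lambda>a b. adj (f a) (f b)) w"
    unfolding realizes_def clique_def by simp_all
  have adj: "adj (f a) (f b)" if "a \<in> set vs" "b \<in> set vs" "a \<noteq> b" for a b
    using W[of "[a, b]"] that by (simp add: in_pairs)
  have "is_clique (f ` set vs)"
    using f(2) adj unfolding is_clique_def by auto
  moreover have "card (f ` set vs) = length vs"
    using f(1) assms(2) by (simp add: card_image distinct_card)
  ultimately show False using assms(1) by blast
qed

text \<open>The graph is connected, because non-adjacent vertices are joined by a path.\<close>

lemma ex_adj_crossing:
  assumes "u \<in> verts" "u \<notin> Q" "q \<in> Q" "Q \<subseteq> verts"
  shows "\<exists>w x. w \<notin> Q \<and> x \<in> Q \<and> adj w x"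
proof (cases "adj u q")
  case False
  then obtain p where p: "simple_path adj p" "length p = 9" "hd p = u" "last p = q"
    using ex_path[of u q] assms by blast
  have "\<exists>w x. w \<notin> Q \<and> x \<in> Q \<and> adj w x" if "successively adj p" "p \<noteq> []" "hd p \<notin> Q" "last p \<in> Q" for p
    using that by (induction p rule: induct_list012) (auto split: if_splits)
  then show ?thesis using p assms unfolding simple_path_def by fastforce
qed (use assms in blast)

text \<open>Otherwise \<open>x w z y\<close> is a four-cycle whose only chord is \<open>x z\<close>.\<close>

lemma adj_unique_in_clique:
  assumes d: "forbidden diamond" and Q: "is_clique Q" and w: "w \<notin> Q" "x \<in> Q" "adj w x" and y: "y \<in> Q" "\<not> adj w y"
    and z: "z \<in> Q" "adj w z"
  shows "z = x"
proof (rule ccontr)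
  assume "z \<noteq> x"
  define f where "f = (\<lambda>c. if c = CHR ''a'' then x else if c = CHR ''b'' then w else if c = CHR ''c'' then z else y)"
  have "x \<noteq> y" "z \<noteq> y" "w \<noteq> x" "w \<noteq> y" "w \<noteq> z" using w y z by auto
  then have "realizes f diamond"
    using Q w y z \<open>z \<noteq> x\<close> adj_sym[OF w(3)] adj_sym[OF z(2)] adj_verts
    unfolding realizes_def diamond_def is_clique_def f_def by (auto simp: inj_on_def)
  then show False using d unfolding forbidden_def by blast
qed

text \<open>If there is no clique of \<open>m + 1\<close> vertices, a vertex \<open>w\<close> adjacent to some vertex of a clique of \<open>m\<close>
vertices misses another vertex of it, and then it is a pendant vertex of the clique.\<close>

lemma forbidden_clique_step:
  assumes d: "forbidden diamond" and larger: "forbidden (clique vs)" and pendant: "forbidden (pendant_clique vs)"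
    and vs: "distinct vs" "3 \<le> length vs" "length vs \<le> 9" and us: "distinct us" "length vs = Suc (length us)"
  shows "forbidden (clique us)"
proof (rule forbidden_cliqueI[OF _ us(1)], rule notI)
  fix Q assume Q: "is_clique Q" "finite Q" and card: "card Q = length us"
  have "Q \<noteq> {}" "\<not> verts \<subseteq> Q"
    using card us(2) vs(2,3) Q(2) card_mono[of Q verts] nine_verts by auto
  then obtain u q where "u \<in> verts" "u \<notin> Q" "q \<in> Q" by blast
  moreover have "Q \<subseteq> verts" using Q(1) by (simp add: is_clique_def)
  ultimately obtain w x where w: "w \<notin> Q" "x \<in> Q" "adj w x"
    using ex_adj_crossing[of u Q q] by blast
  have "\<exists>y\<in>Q. \<not> adj w y"
  proof (rule ccontr)
    assume "\<not> ?thesis"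
    then have "is_clique (insert w Q)"
      using Q(1) adj_sym adj_verts[OF w(3)] unfolding is_clique_def by auto
    moreover have "card (insert w Q) = length vs"
      using w(1) Q(2) card us(2) by simp
    ultimately show False
      using not_clique_if_forbidden[OF larger vs(1)] Q(2) by blast
  qed
  then obtain y where y: "y \<in> Q" "\<not> adj w y" by blast
  have only: "\<not> adj w z" if "z \<in> Q" "z \<noteq> x" for z
    using adj_unique_in_clique[OF d Q(1) w y] that by blast
  obtain a b cs where abc: "vs = a # b # cs"
    using vs(2) by (cases vs; cases "tl vs") auto
  have "card (set cs) = card (Q - {x})"
    using abc vs(1) card us(2) Q(2) w(2) by (simp add: distinct_card)
  then obtain g where g: "bij_betw g (set cs) (Q - {x})"
    using finite_same_card_bij[of "set cs" "Q - {x}"] Q(2) by auto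
  define f where "f = g(a := w, b := x)"
  have f: "f a = w" "f b = x" "\<And>c. c \<in> set cs \<Longrightarrow> f c = g c"
    using abc vs(1) unfolding f_def by auto
  have gQ: "g c \<in> Q" "g c \<noteq> x" "g c \<noteq> w" if "c \<in> set cs" for c
    using g that w(1) unfolding bij_betw_def by auto
  have inj: "inj_on f (set vs)"
    using g f gQ w abc unfolding bij_betw_def inj_on_def by (auto; metis)
  have "f ` set vs \<subseteq> verts"
    using f gQ w Q(1) adj_verts[OF w(3)] abc unfolding is_clique_def by auto
  moreover have fQ: "f c \<in> Q" if "c \<in> set (b # cs)" for c using that f gQ w by auto
  have "adj (f c) (f c')" if "c \<in> set (b # cs)" "c' \<in> set (b # cs)" "c \<noteq> c'" for c c'
  proof -
    have "f c \<noteq> f c'" using inj_onD[OF inj, of c c'] that abc by auto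
    then show ?thesis using fQ[OF that(1)] fQ[OF that(2)] Q(1) unfolding is_clique_def by blast
  qed
  moreover have "\<not> adj (f a) (f c)" if "c \<in> set cs" for c
    using only gQ[OF that] f that by simp
  ultimately have "realizes f (pendant_clique vs)"
    using inj w(3) f(1,2) unfolding realizes_def pendant_clique_def abc
    by (auto simp: in_pairs numeral_2_eq_2)
  then show False using pendant unfolding forbidden_def by blast
qed

lemma not_forbidden_edge: "\<not> forbidden (clique ''ab'')"
proof
  assume no: "forbidden (clique ''ab'')"
  have no_adj: "\<not> adj x y" for x y
  proof
    assume xy: "adj x y"
    then have "x \<noteq> y" using adj_irrefl by auto
    then have "is_clique {x, y}" "card {x, y} = 2"
      using xy adj_sym[OF xy] adj_verts adj_verts2 unfolding is_clique_def by auto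
    then show False using not_clique_if_forbidden[OF no, of "{x, y}"] by simp
  qed
  have "2 \<le> card verts" using nine_verts by simp
  then obtain x y where "x \<in> verts" "y \<in> verts" "x \<noteq> y"
    by (auto simp: card_le_Suc_iff numeral_2_eq_2)
  then obtain p where p: "simple_path adj p" "length p = 9"
    using ex_path no_adj by blast
  then show False
    using no_adj unfolding simple_path_def by (cases p; cases "tl p") auto
qed

end

section \<open>Saturated graphs and paths of length eight\<close>

definition cycle_of :: "'a list \<Rightarrow> 'a pair_pre_digraph" where
  "cycle_of p = \<lparr> pverts = set p, parcs = map_prod ((!) p) ((!) p) ` parcs (cycle_graph (length p)) \<rparr>"

lemma verts_cycle_of [simp]: "pverts (cycle_of p) = set p"
  by (simp add: cycle_of_def)

lemma arcs_cycle_of: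
  "(x, y) \<in> parcs (cycle_of p) \<longleftrightarrow>
     (\<exists>i j. x = p ! i \<and> y = p ! j \<and> i < length p \<and> j < length p
        \<and> (j = Suc i mod length p \<or> i = Suc j mod length p))"
  by (force simp: cycle_of_def cycle_graph_def)

lemma sym_cycle_of: "(x, y) \<in> parcs (cycle_of p) \<Longrightarrow> (y, x) \<in> parcs (cycle_of p)"
  unfolding arcs_cycle_of by blast

lemma pair_graph_cycle_of:
  assumes "distinct p" "2 \<le> length p"
  shows "pair_graph (cycle_of p)"
proof -
  have "finite (set p \<times> set p)" by simp
  moreover have sub: "parcs (cycle_of p) \<subseteq> set p \<times> set p" by (auto simp: arcs_cycle_of)
  ultimately have "finite (parcs (cycle_of p))" by (rule finite_subset[rotated])
  moreover have "symmetric (with_proj (cycle_of p))"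
    using sym_cycle_of by (auto simp: symmetric_def intro!: symI)
  moreover have "fst e \<noteq> snd e" if "e \<in> parcs (cycle_of p)" for e
  proof -
    have "(fst e, snd e) \<in> parcs (cycle_of p)" using that by simp
    then obtain i j where e: "fst e = p ! i" "snd e = p ! j"
      and ij: "i < length p" "j < length p" "j = Suc i mod length p \<or> i = Suc j mod length p"
      unfolding arcs_cycle_of by blast
    have "i \<noteq> j" using ij assms(2) by (auto simp: mod_Suc split: if_splits)
    then show ?thesis using e ij assms(1) by (simp add: nth_eq_iff_index_eq)
  qed
  ultimately show ?thesis using sub by unfold_locales auto
qed

lemma pair_graph_cycle_graph:
  assumes "2 \<le> t"
  shows "pair_graph (cycle_graph t)"
proof -
  have "map_prod ((!) [0..<t]) ((!) [0..<t]) ` parcs (cycle_graph t) = id ` parcs (cycle_graph t)"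
    by (intro image_cong) (auto simp: cycle_graph_def)
  then have "cycle_of [0..<t] = cycle_graph t"
    by (intro pair_pre_digraph.equality) (auto simp: cycle_of_def cycle_graph_def)
  then show ?thesis using assms pair_graph_cycle_of[of "[0..<t]"] by simp
qed

text \<open>Arcs of a pair digraph are determined by their ends, so an isomorphism from the standard cycle is
determined by the list of the images of \<open>0, 1, \<dots>, t - 1\<close>.\<close>

lemma cycle_in_iff:
  assumes "pair_graph G" "2 \<le> t"
  shows "cycle_in t G H \<longleftrightarrow>
    (\<exists>p. length p = t \<and> distinct p \<and> H = cycle_of p \<and> set p \<subseteq> pverts G \<and> parcs H \<subseteq> parcs G)"
    (is "?l \<longleftrightarrow> ?r")
proof
  interpret C: pair_graph "cycle_graph t" by (rule pair_graph_cycle_graph) fact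
  assume ?l
  then obtain h where h: "C.digraph_isomorphism h" "with_proj H = app_iso h (with_proj (cycle_graph t))"
    and sub: "pverts H \<subseteq> pverts G" "parcs H \<subseteq> parcs G"
    by (auto simp: cycle_in_def digraph_iso_def subgraph_def)
  define f where "f = iso_verts h"
  define p where "p = map f [0..<t]"
  have V: "pverts H = f ` {..<t}"
    using arg_cong[OF h(2), of verts] by (simp add: f_def cycle_graph_def)
  have "iso_tail h = fst" "iso_head h = snd"
    using arg_cong[OF h(2), of tail] arg_cong[OF h(2), of head] by simp_all
  then have arc: "iso_arcs h (i, j) = (f i, f j)" if "(i, j) \<in> parcs (cycle_graph t)" for i j
    using that h(1) unfolding C.digraph_isomorphism_def f_def by (metis fst_conv snd_conv prod.collapse)
  have "parcs H = iso_arcs h ` parcs (cycle_graph t)"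
    using arg_cong[OF h(2), of arcs] by simp
  also have "\<dots> = map_prod ((!) p) ((!) p) ` parcs (cycle_graph t)"
    using arc by (intro image_cong) (auto simp: p_def cycle_graph_def)
  finally have "H = cycle_of p"
    using V by (intro pair_pre_digraph.equality) (auto simp: cycle_of_def p_def)
  moreover have "distinct p"
    using h(1) unfolding C.digraph_isomorphism_def p_def f_def
    by (auto simp: distinct_map cycle_graph_def lessThan_atLeast0)
  ultimately show ?r using sub by (intro exI[of _ p]) (auto simp: p_def)
next
  assume ?r
  then obtain p where p: "length p = t" "distinct p" "H = cycle_of p" "set p \<subseteq> pverts G" "parcs H \<subseteq> parcs G"
    by blast
  interpret C: pair_graph "cycle_graph t" by (rule pair_graph_cycle_graph) fact
  interpret G: pair_graph G by fact
  interpret H: pair_graph H using pair_graph_cycle_of p assms(2) by blast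
  have "pverts H \<subseteq> pverts G" using p(3,4) by simp
  then have "subgraph (with_proj H) (with_proj G)"
    using p(5) G.wf_digraph_axioms H.wf_digraph_axioms unfolding subgraph_def compatible_def by simp
  moreover
  define h where "h = \<lparr> iso_verts = nth p, iso_arcs = map_prod (nth p) (nth p), iso_head = snd, iso_tail = fst \<rparr>"
  have "C.digraph_isomorphism h"
    using p(1,2) C.wf_digraph_axioms unfolding C.digraph_isomorphism_def h_def
    by (auto simp: inj_on_def cycle_graph_def nth_eq_iff_index_eq)
  moreover have "with_proj H = app_iso h (with_proj (cycle_graph t))"
    using p(1,3) unfolding with_proj_def app_iso_def h_def
    by (auto simp: cycle_of_def cycle_graph_def set_conv_nth)
  ultimately show ?l
    unfolding cycle_in_def digraph_iso_def using H.pair_graph by blast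
qed

text \<open>Once two consecutive vertices are known, the next vertex of a cycle is the other neighbour of the
second one. The first and the last vertex are consecutive, so they determine the whole list.\<close>

lemma cycle_of_inject:
  assumes p: "distinct p" "length p = n" and q: "distinct q" "length q = n" and n: "3 \<le> n"
    and eq: "cycle_of p = cycle_of q" and hd: "hd p = hd q" and last: "last p = last q"
  shows "p = q"
proof -
  have ne: "p \<noteq> []" "q \<noteq> []" using p q n by auto
  have "i < n \<Longrightarrow> p ! i = q ! i" for i
  proof (induction i rule: less_induct)
    case (less i)
    show ?case
    proof (cases i)
      case 0
      then show ?thesis using hd ne by (simp add: hd_conv_nth)
    next
      case (Suc k)
      define l where "l = (if k = 0 then n - 1 else k - 1)"
      have l: "l < n" "p ! l = q ! l" and pred: "\<And>j. j < n \<Longrightarrow> k = Suc j mod n \<Longrightarrow> j = l"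
        using less Suc n last ne p(2) q(2)
        by (auto simp: l_def last_conv_nth mod_Suc split: if_splits)
      have k: "k < n" "p ! k = q ! k" "Suc k mod n = i" using less Suc by auto
      have "(p ! k, p ! i) \<in> parcs (cycle_of p)"
        unfolding arcs_cycle_of using k less.prems p(2) by (intro exI[of _ k] exI[of _ i]) auto
      then obtain a b where ab: "p ! k = q ! a" "p ! i = q ! b" "a < n" "b < n" "b = Suc a mod n \<or> a = Suc b mod n"
        unfolding eq using q(2) by (auto simp: arcs_cycle_of)
      have "a = k" using ab k q by (metis nth_eq_iff_index_eq)
      then have "b = i \<or> b = l" using ab k pred by auto
      moreover have "i \<noteq> l" using Suc n less.prems by (auto simp: l_def)
      then have "b \<noteq> l" using ab l p less.prems by (metis nth_eq_iff_index_eq)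
      ultimately show ?thesis using ab by simp
    qed
  qed
  then show ?thesis using p q by (intro nth_equalityI) auto
qed

lemma cycle_of_arcs_subset:
  assumes "successively (\<lambda>x y. (x, y) \<in> A) p" "(last p, hd p) \<in> A" "sym A"
  shows "parcs (cycle_of p) \<subseteq> A"
proof -
  have step: "(p ! i, p ! (Suc i mod length p)) \<in> A" if "i < length p" for i
  proof (cases "Suc i < length p")
    case True
    then show ?thesis using assms(1) by (simp add: successively_conv_nth)
  next
    case False
    then have "i = length p - 1" "Suc i = length p" "p \<noteq> []" using that by auto
    then show ?thesis using assms(2) by (simp add: last_conv_nth hd_conv_nth)
  qed
  show ?thesis
    using step symD[OF assms(3) step] by (auto simp: arcs_cycle_of)
qed

text \<open>Cutting a cycle open at one of its edges leaves a path between the ends of that edge.\<close>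

lemma path_if_cycle_arc:
  assumes p: "distinct p" "length p = n" "3 \<le> n" and xy: "(x, y) \<in> parcs (cycle_of p)"
  shows "\<exists>q. distinct q \<and> length q = n \<and> hd q = x \<and> last q = y
    \<and> successively (\<lambda>a b. (a, b) \<in> parcs (cycle_of p) - {(x, y), (y, x)}) q"
proof -
  have cut: "\<exists>q. distinct q \<and> length q = n \<and> hd q = y \<and> last q = x
      \<and> successively (\<lambda>a b. (a, b) \<in> parcs (cycle_of p) - {(x, y), (y, x)}) q"
    if i: "i < n" "x = p ! i" "y = p ! (Suc i mod n)" for i x y
  proof -
    define q where "q = rotate (Suc i) p"
    have q: "distinct q" "length q = n" using p by (auto simp: q_def)
    have nth: "q ! k = p ! ((Suc i + k) mod n)" if "k < n" for k
      using that p nth_rotate[of k p "Suc i"] by (simp add: q_def del: rotate_Suc)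
    have ne: "q \<noteq> []" using q p by auto
    have hd: "hd q = y" using nth[of 0] ne p i by (simp add: hd_conv_nth)
    have "(Suc i + (n - 1)) mod n = i" using p(3) i(1) by simp
    then have last: "last q = x" using nth[of "n - 1"] ne q p i by (simp add: last_conv_nth)
    have "(q ! k, q ! Suc k) \<in> parcs (cycle_of p) - {(x, y), (y, x)}" if k: "Suc k < n" for k
    proof -
      have "Suc ((Suc i + k) mod n) mod n = (Suc i + Suc k) mod n" by (simp add: mod_Suc_eq)
      then have "(q ! k, q ! Suc k) \<in> parcs (cycle_of p)"
        unfolding arcs_cycle_of using nth[of k] nth[of "Suc k"] k p
        by (intro exI[of _ "(Suc i + k) mod n"] exI[of _ "(Suc i + Suc k) mod n"]) auto
      moreover have "q ! k \<noteq> x" using q k last ne by (auto simp: last_conv_nth nth_eq_iff_index_eq)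
      moreover have "q ! Suc k \<noteq> y" using q k hd ne by (auto simp: hd_conv_nth nth_eq_iff_index_eq)
      moreover have "\<not> (q ! k = y \<and> q ! Suc k = x)"
      proof
        assume "q ! k = y \<and> q ! Suc k = x"
        then have "k = 0" "Suc k = n - 1"
          using q k hd last ne by (auto simp: hd_conv_nth last_conv_nth nth_eq_iff_index_eq)
        then show False using p(3) by simp
      qed
      ultimately show ?thesis by auto
    qed
    then show ?thesis using q hd last by (intro exI[of _ q]) (simp add: successively_conv_nth)
  qed
  obtain i j where ij: "x = p ! i" "y = p ! j" "i < n" "j < n" "j = Suc i mod n \<or> i = Suc j mod n"
    using xy p(2) by (auto simp: arcs_cycle_of)
  from ij(5) show ?thesis
  proof
    assume "j = Suc i mod n"
    then obtain q where q: "distinct q" "length q = n" "hd q = y" "last q = x"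
      and s: "successively (\<lambda>a b. (a, b) \<in> parcs (cycle_of p) - {(x, y), (y, x)}) q"
      using cut[OF ij(3,1)] ij by auto
    have "successively (\<lambda>a b. (a, b) \<in> parcs (cycle_of p) - {(x, y), (y, x)}) (rev q)"
      using s sym_cycle_of[of _ _ p] by (auto elim!: successively_mono)
    then show ?thesis using q by (intro exI[of _ "rev q"]) (auto simp: hd_rev last_rev)
  next
    assume "i = Suc j mod n"
    then show ?thesis using cut[OF ij(4,2)] ij by (auto simp: insert_commute)
  qed
qed

lemma pair_graph_add_edge:
  assumes "pair_graph G" "u \<in> pverts G" "v \<in> pverts G" "u \<noteq> v"
  shows "pair_graph (add_edge G u v)"
proof -
  interpret G: pair_graph G by fact
  show ?thesis
    using assms(2-4) G.pair_finite_verts G.pair_finite_arcs G.pair_no_loops G.in_arcsD1 G.in_arcsD2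
      G.arcs_symmetric
    by unfold_locales (auto simp: add_edge_def symmetric_def intro!: symI)
qed

text \<open>A path of length eight between non-adjacent vertices is a nine-cycle of the graph with the missing edge
added. Conversely, the nine-cycle that appears with a new edge has to use it, because the graph itself has
no nine-cycle, and it can be cut open there.\<close>

lemma unique_eight_paths_if_saturated:
  assumes "nontrivial_uniquely_cycle_saturated 9 G"
  shows "unique_eight_paths (pverts G) (\<lambda>x y. (x, y) \<in> parcs G)"
proof -
  have G: "pair_graph G" and no_cycle: "\<And>H. \<not> cycle_in 9 G H" and large: "9 \<le> card (pverts G)"
    and sat: "\<And>u v. u \<in> pverts G \<Longrightarrow> v \<in> pverts G \<Longrightarrow> u \<noteq> v \<Longrightarrow> (u, v) \<notin> parcs G
      \<Longrightarrow> \<exists>!H. cycle_in 9 (add_edge G u v) H"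
    using assms by (auto simp: nontrivial_uniquely_cycle_saturated_def uniquely_cycle_saturated_def)
  interpret pair_graph G by fact
  have nine: "2 \<le> (9 :: nat)" by simp
  have symG: "sym (parcs G)" using arcs_symmetric by (auto intro: symI)
  have in_verts: "set p \<subseteq> pverts G" if "successively (\<lambda>x y. (x, y) \<in> parcs G) p" "length p = 9" for p
  proof -
    have "set p \<subseteq> pverts G" if "successively (\<lambda>x y. (x, y) \<in> parcs G) p" "length p \<noteq> 1" for p
      using that
    proof (induction p rule: induct_list012)
      case (3 a b p)
      then show ?case using in_arcsD1[of a b] in_arcsD2[of a b] by (cases p) auto
    qed auto
    then show ?thesis using that by simp
  qed
  have no_nine: "(last p, hd p) \<notin> parcs G"
    if p: "simple_path (\<lambda>x y. (x, y) \<in> parcs G) p" "length p = 9" for p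
  proof
    assume "(last p, hd p) \<in> parcs G"
    then have "cycle_in 9 G (cycle_of p)"
      unfolding cycle_in_iff[OF G nine]
      using p cycle_of_arcs_subset[OF _ _ symG, of p] in_verts[of p]
      by (intro exI[of _ p]) (simp add: simple_path_def)
    then show False using no_cycle by blast
  qed
  show ?thesis
  proof
    show "(y, x) \<in> parcs G" if "(x, y) \<in> parcs G" for x y using arcs_symmetric that .
    show "(x, x) \<notin> parcs G" for x using pair_no_loops[of "(x, x)"] by auto
    show "x \<in> pverts G" if "(x, y) \<in> parcs G" for x y using in_arcsD1 that .
    show "9 \<le> card (pverts G)" by fact
    show "(last p, hd p) \<notin> parcs G"
      if "simple_path (\<lambda>x y. (x, y) \<in> parcs G) p" "length p = 9" for p
      using no_nine that .
    show "p = q" if p: "simple_path (\<lambda>x y. (x, y) \<in> parcs G) p" "length p = 9"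
      and q: "simple_path (\<lambda>x y. (x, y) \<in> parcs G) q" "length q = 9"
      and ends: "hd p = hd q" "last p = last q" for p q
    proof -
      let ?u = "last p" and ?v = "hd p"
      have V: "set p \<subseteq> pverts G" "set q \<subseteq> pverts G"
        using in_verts p q unfolding simple_path_def by auto
      have "p \<noteq> []" "q \<noteq> []" using p q by auto
      then have uv: "?u \<in> pverts G" "?v \<in> pverts G" using V by auto
      have "?u = p ! 8" "?v = p ! 0"
        using p(2) \<open>p \<noteq> []\<close> by (simp_all add: last_conv_nth hd_conv_nth)
      then have "?u \<noteq> ?v"
        using p nth_eq_iff_index_eq[of p 8 0] by (simp add: simple_path_def)
      note uv = uv this no_nine[OF p]
      let ?G = "add_edge G ?u ?v"
      have add: "pverts ?G = pverts G" "parcs ?G = parcs G \<union> {(?u, ?v), (?v, ?u)}"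
        by (auto simp: add_edge_def)
      have G': "pair_graph ?G" using pair_graph_add_edge[OF G uv(1-3)] .
      have "sym (parcs ?G)" using symG add by (auto simp: sym_def)
      then have arcs: "parcs (cycle_of r) \<subseteq> parcs ?G"
        if "successively (\<lambda>x y. (x, y) \<in> parcs G) r" "hd r = ?v" "last r = ?u" for r
        using that add by (intro cycle_of_arcs_subset) (auto elim: successively_mono)
      have "cycle_in 9 ?G (cycle_of r)"
        if "simple_path (\<lambda>x y. (x, y) \<in> parcs G) r" "length r = 9" "hd r = ?v" "last r = ?u" for r
        unfolding cycle_in_iff[OF G' nine]
        using that arcs[of r] in_verts[of r] add(1) by (intro exI[of _ r]) (simp add: simple_path_def)
      then have "cycle_in 9 ?G (cycle_of p)" "cycle_in 9 ?G (cycle_of q)"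
        using p q ends by simp_all
      then have "cycle_of p = cycle_of q" using sat[OF uv] by blast
      then show "p = q"
        using cycle_of_inject[of p 9 q] p q ends unfolding simple_path_def by simp
    qed
    show "\<exists>p. simple_path (\<lambda>x y. (x, y) \<in> parcs G) p \<and> length p = 9 \<and> hd p = x \<and> last p = y"
      if xy: "x \<in> pverts G" "y \<in> pverts G" "x \<noteq> y" "(x, y) \<notin> parcs G" for x y
    proof -
      let ?G = "add_edge G x y"
      have add: "pverts ?G = pverts G" "parcs ?G = parcs G \<union> {(x, y), (y, x)}"
        by (auto simp: add_edge_def)
      have G': "pair_graph ?G" using pair_graph_add_edge[OF G xy(1-3)] .
      obtain H where "cycle_in 9 ?G H" using sat[OF xy] by blast
      then obtain p where p: "length p = 9" "distinct p" "set p \<subseteq> pverts G" "parcs (cycle_of p) \<subseteq> parcs ?G"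
        unfolding cycle_in_iff[OF G' nine] add(1) by blast
      have "cycle_in 9 G (cycle_of p)" if "parcs (cycle_of p) \<subseteq> parcs G"
        unfolding cycle_in_iff[OF G nine] using that p(1-3) by (intro exI[of _ p]) simp
      then have "\<not> parcs (cycle_of p) \<subseteq> parcs G"
        using no_cycle by blast
      then have "(x, y) \<in> parcs (cycle_of p) \<or> (y, x) \<in> parcs (cycle_of p)"
        using p(4) add(2) by blast
      then have "(x, y) \<in> parcs (cycle_of p)"
        using sym_cycle_of[of y x p] by blast
      then obtain q where "distinct q" "length q = 9" "hd q = x" "last q = y"
        and s: "successively (\<lambda>a b. (a, b) \<in> parcs (cycle_of p) - {(x, y), (y, x)}) q"
        using path_if_cycle_arc[of p 9 x y] p by auto
      moreover have "successively (\<lambda>a b. (a, b) \<in> parcs G) q"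
        using s by (rule successively_mono) (use p(4) add(2) in blast)
      ultimately show ?thesis unfolding simple_path_def by blast
    qed
  qed
qed

section \<open>Excluded configurations\<close>

text \<open>In the statements below the first list holds the configurations, excluded before, that the certificate
refers to by their index.\<close>

definition square :: config where
  "square = (''abcd'', [''abcda''], [''ac'', ''bd''])"

definition cycle :: "string \<Rightarrow> config" where
  "cycle vs = (vs, [vs @ [hd vs]], [])"

text \<open>Two cycles that share the edge \<open>ab\<close> and no other vertex.\<close>

definition glued_cycles :: "string \<Rightarrow> string \<Rightarrow> config" where
  "glued_cycles us vs = (''ab'' @ us @ vs, [''ab'' @ us @ ''a'', ''a'' @ vs @ ''b''], [])"

lemma no_clique9_cert: "refutes [] (clique ''abcdefghi'') [
  ''Nabcdefghi'']"
  by code_simp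

text \<open>The two vertices of degree two of a diamond are not adjacent, and the same is true for opposite vertices
of an induced four-cycle. The certificates follow the path of length eight between them; in both cases the
four-cycle offers two ways of equal length between them, and this produces two paths of length eight with
common ends.\<close>

lemma no_diamond_cert: "refutes [] diamond [
  ''Jbd Xa Xc Xe Xf Xg Xh Xi Sdi Ndihgfecba D D D D D D Xe Xc F Xf Xg Xh Chi Teabcdfghiecbadfghi D'',
  ''D D D Xf Xc F Xg Xh Chi Tbaefcdghibcfeadghi D D D Xg Xc F Xh Chi Tbaefgcdhibcgfeadhi D D Xh Xc'',
  ''Cdi Tbaefghcdibchgfeadi F D Xi Cij Tcbaefghijcdaefghij Sci Tbaefghicdbcihgfead D D D D D D Xc'',
  ''Xa Xe Xf Xg Xh Xi Sdi Ndihgfeabc D D D D D D Xe Xa F Xf Xg Xh Chi Teabcdfghiecbadfghi D D D D'',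
  ''Xf Xa F Xg Xh Chi Tbafecdghibcefadghi D D D Xg Xa F Xh Chi Tbagfecdhibcefgadhi D D Xh Xa Cdi'',
  ''Tbahgfecdibcefghadi F D Xi Cij Tabcefghijadcefghij Sai Tbaihgfecdbcefghiad D D D D D D Xe Xa'',
  ''Xc Xf Xg Xh Xi Sdi Ndihgfcbea D D D D D Xf Xc F Xg Xh Chi Tfaebcdghifcbeadghi D D D Xg Xc F Xh'',
  ''Chi Tebafgcdhiebcgfadhi D D Xh Xc Cdi Tebafghcdiebchgfadi F D Xi Sci Tdafghicbedcihgfabe Xj'',
  ''Sdj Ndjihgfabc D D D D D D Xc Xa Xf Xg Xh Xi Sdi Ndihgfabec D D D D D Xf Xa F Xg Xh Chi'',
  ''Tfabecdghifcebadghi D D D Xg Xa F Xh Chi Tebagfcdhiebcfgadhi D D Xh Xa Cdi Tebahgfcdiebcfghadi'',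
  ''F D Xi Sai Tdaihgfcbedcfghiabe Xj Sdj Ndjihgfcba D D D D D D Xf Xa F Xc F Xg Xh Xi Sci'',
  ''Tdaghicbefdcihgabef D D D D Xg Xc F Xh Xi Sci Tfebahicdgfebcihadg D D D Xh Chi'',
  ''Tfebacdghifebcadghi Xc F Xi Sci Thgdafebcihgdcbefai D D D D D Xc F Xa F Xg Xh Xi Sai'',
  ''Tdaihgcbefdcghiabef D D D D Xg Xa F Xh Xi Sai Tfebaihcdgfebchiadg D D D Xh Chi'',
  ''Tfebacdghifebcadghi Xa F Xi Sai Thgdabefcihgdcfebai D D D D D Xg Xa F Xc F Xh Xi Sci'',
  ''Tdahicbefgdcihabefg D D D Xh Chi Tgfebacdhigfebcadhi Xc F Xi Sci Thdagfebcihdcbefgai D D D D'',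
  ''Xc F Xa F Xh Xi Sai Tdaihcbefgdchiabefg D D D Xh Chi Tgfebacdhigfebcadhi Xa F Xi Sai'',
  ''Thdabefgcihdcgfebai D D D D Xh Chi Tdacbefghidcabefghi Cdi Thgfebacdihgfebcadi Xa F Xc F Xi'',
  ''Sci Tdahgfebcidcbefghai D D D Xc F Xa F Xi Sai Tdabefghcidchgfebai D D D D D D D D'']"
  by code_simp

lemma no_square_cert: "refutes [] square [
  ''Jac Xb Xe Xd F Xf Xg Xh Chi Tebadcfghiedabcfghi D D D D Xf Xd F Xg Xh Chi Tabefdcghiadfebcghi'',
  ''D D D Xg Xd F Xh Chi Tabefgdchiadgfebchi D D Xh Xd Cci Tabefghdciadhgfebci F D Xi Cij'',
  ''Tdabefghijdcbefghij Sdi Tabefghidcadihgfebc D D D D D D Xd Xe Xb F Xf Xg Xh Chi'',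
  ''Tebadcfghiedabcfghi D D D D Xf Xb F Xg Xh Chi Tabfedcghiadefbcghi D D D Xg Xb F Xh Chi'',
  ''Tabgfedchiadefgbchi D D Xh Xb Cci Tabhgfedciadefghbci F D Xi Cij Tbadefghijbcdefghij Sbi'',
  ''Tabihgfedcadefghibc D D D D D D Xe Xb Xf Xd F Xg Xh Chi Tfbeadcghifdaebcghi D D D Xg Xd F Xh'',
  ''Chi Teabfgdchieadgfbchi D D Xh Xd Cci Teabfghdcieadhgfbci F D Xi Sdi Tcbfghidaecdihgfbae Xj'',
  ''Scj Ncjihgfbad D D D D D D Xd Xf Xb F Xg Xh Chi Tfbaedcghifdeabcghi D D D Xg Xb F Xh Chi'',
  ''Teabgfdchieadfgbchi D D Xh Xb Cci Teabhgfdcieadfghbci F D Xi Sbi Tcbihgfdaecdfghibae Xj Scj'',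
  ''Ncjihgfdab D D D D D D Xf Xb Xg Xd F Xh Chi Tgbfeadchigdaefbchi D D Xh Xd Cci'',
  ''Tfeabghdcifeadhgbci F D Xi Sdi Tcbghidaefcdihgbaef Xj Scj Tdcjihgbaedcjihgbfe D D D D D Xd Xg'',
  ''Xb F Xh Chi Tgbaefdchigdfeabchi D D Xh Xb Cci Tfeabhgdcifeadghbci F D Xi Sbi'',
  ''Tcbihgdaefcdghibaef Xj Scj Tbcjihgdaebcjihgdfe D D D D D Xg Xb Xh Xd Cci Thbgfeadcihdaefgbci F'',
  ''D Xi Sdi Tcbhidaefgcdihbaefg Xj Scj Tgfeabcjihgfeadcjih D D D D Xd Xh Xb Cci'',
  ''Thbaefgdcihdgfeabci F D Xi Sbi Tcbihdaefgcdhibaefg Xj Scj Tgfeabcjihgfeadcjih D D D D Xh Xb Xi'',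
  ''Sdi Tcbhgfeadicdaefghbi Xj Scj Thgfeabcjihgfeadcbi D D D Xd Xi Sbi Tcbaefghdicdhgfeabi Xj Scj'',
  ''Thgfeabcdihgfeabcji D D D Xi Cij Tcbaefghijcdaefghij Sbi Nbihgfeadc Sdi Ndihgfeabc D D D D D D'']"
  by code_simp

text \<open>The larger a clique, the more freedom there is in rerouting a path inside it. So hardly any path can leave
a clique and come back to it: a path of length two between clique vertices is impossible because of
diamonds and larger cliques, one of length three because of induced four-cycles, and for a clique of \<open>m\<close>
vertices the lengths from \<open>10 - m\<close> to \<open>8\<close> close up to nine-cycles. Only the lengths four and five need an
analysis of their own. Without such ears, the path of length eight from the pendant vertex to
another vertex of the clique stays in the clique once it has entered it, which leaves few possibilities.\<close>

lemma no_pendant_clique8_cert: "refutes [] (pendant_clique ''abcdefghi'') [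
  ''Tabhcidgefabhdicgef'']"
  by code_simp

lemma no_pendant_clique7_cert: "refutes [] (pendant_clique ''abcdefgh'') [
  ''Chi Tabcdefghiabcdegfhi Cgi Tabcdefhgiabcdehfgi Cfi Tabcdeghfiabcdehgfi Cei'',
  ''Tabcdfgheiabcdfhgei Cdi Tabcefghdiabcefhgdi Cci Tabdefghciabdefhgci Cai Thcdefgbaihcdegfbai'',
  ''Jac Xb F Xd Xe Xf Xg Xh D D Xh Xg D D D Xg Xf Xh D D Xh Xf D D D Xh Xf Xg D D Xg Xf D D D D Xf'',
  ''Xe Xg Xh D D Xh Xg D D D Xg Xe Xh D D Xh Xe D D D Xh Xe Xg D D Xg Xe D D D D Xg Xe Xf Xh D D'',
  ''Xh Xf D D D Xf Xe Xh D D Xh Xe D D D Xh Xe Xf D D Xf Xe D D D D Xh Xe Xf Xg D D Xg Xf D D D Xf'',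
  ''Xe Xg D D Xg Xe D D D Xg Xe Xf D D Xf Xe D D D D D Xe Xd Xf Xg Xh D D Xh Xg D D D Xg Xf Xh D D'',
  ''Xh Xf D D D Xh Xf Xg D D Xg Xf D D D D Xf Xd Xg Xh D D Xh Xg D D D Xg Xd Xh D D Xh Xd D D D Xh'',
  ''Xd Xg D D Xg Xd D D D D Xg Xd Xf Xh D D Xh Xf D D D Xf Xd Xh D D Xh Xd D D D Xh Xd Xf D D Xf'',
  ''Xd D D D D Xh Xd Xf Xg D D Xg Xf D D D Xf Xd Xg D D Xg Xd D D D Xg Xd Xf D D Xf Xd D D D D D'',
  ''Xf Xd Xe Xg Xh D D Xh Xg D D D Xg Xe Xh D D Xh Xe D D D Xh Xe Xg D D Xg Xe D D D D Xe Xd Xg Xh'',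
  ''D D Xh Xg D D D Xg Xd Xh D D Xh Xd D D D Xh Xd Xg D D Xg Xd D D D D Xg Xd Xe Xh D D Xh Xe D D'',
  ''D Xe Xd Xh D D Xh Xd D D D Xh Xd Xe D D Xe Xd D D D D Xh Xd Xe Xg D D Xg Xe D D D Xe Xd Xg D D'',
  ''Xg Xd D D D Xg Xd Xe D D Xe Xd D D D D D Xg Xd Xe Xf Xh D D Xh Xf D D D Xf Xe Xh D D Xh Xe D D'',
  ''D Xh Xe Xf D D Xf Xe D D D D Xe Xd Xf Xh D D Xh Xf D D D Xf Xd Xh D D Xh Xd D D D Xh Xd Xf D D'',
  ''Xf Xd D D D D Xf Xd Xe Xh D D Xh Xe D D D Xe Xd Xh D D Xh Xd D D D Xh Xd Xe D D Xe Xd D D D D'',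
  ''Xh Xd Xe Xf D D Xf Xe D D D Xe Xd Xf D D Xf Xd D D D Xf Xd Xe D D Xe Xd D D D D D Xh Xd Xe Xf'',
  ''Xg D D Xg Xf D D D Xf Xe Xg D D Xg Xe D D D Xg Xe Xf D D Xf Xe D D D D Xe Xd Xf Xg D D Xg Xf D'',
  ''D D Xf Xd Xg D D Xg Xd D D D Xg Xd Xf D D Xf Xd D D D D Xf Xd Xe Xg D D Xg Xe D D D Xe Xd Xg D'',
  ''D Xg Xd D D D Xg Xd Xe D D Xe Xd D D D D Xg Xd Xe Xf D D Xf Xe D D D Xe Xd Xf D D Xf Xd D D D'',
  ''Xf Xd Xe D D Xe Xd D D D D D D D'']"
  by code_simp

lemma no_ear2_on_clique6_cert: "refutes
    [diamond, clique ''abcdefg''] (clique_with_ear ''abcdef'' ''g'') [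
  ''Scg Sdg Seg Sfg 1fgabcde 0afbg 0aebg 0adbg 0acbg'']"
  by code_simp

lemma no_ear3_on_clique6_cert: "refutes
    [square, clique_with_ear ''abcdef'' ''g''] (clique_with_ear ''abcdef'' ''gh'') [
  ''Sah 1abcdefh Sbg 1bacdefg 0abhg'']"
  by code_simp

lemma no_pendant_clique6_cert: "refutes
    [clique_with_ear ''abcdef'' ''g'', clique_with_ear ''abcdef'' ''gh'']
    (pendant_clique ''abcdefg'') [
  ''Jac Xb Xd Xe Xf Xg Xh Chi Tabcdefghiabcdfeghi D D Xh Chi Tabcdegfhiabcdgefhi Sgh 0gfbcdeh D D'',
  ''Xg Xf Xh Chi Tabcdegfhiabcdgefhi D D Xh Chi Tabcdefghiabcdfeghi Sfh 0fgbcdeh D D Xh Chi'',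
  ''Tabcdfgehiabcdgfehi Sfh 0febcdgh Sgh 0gebcdfh D D Xf Xe Xg Xh Chi Tabcdefghiabcdfeghi D D Xh'',
  ''Chi Tabcdfgehiabcdgfehi Sgh 0gebcdfh D D Xg Xe Xh Chi Tabcdfgehiabcdgfehi D D Xh Chi'',
  ''Tabcdefghiabcdfeghi Seh 0egbcdfh D D Xh Chi Tabcdegfhiabcdgefhi Seh 0efbcdgh Sgh 0gfbcdeh D D'',
  ''Xg Xe Xf Xh Chi Tabcdegfhiabcdgefhi D D Xh Chi Tabcdfgehiabcdgfehi Sfh 0febcdgh D D Xf Xe Xh'',
  ''Chi Tabcdfgehiabcdgfehi D D Xh Chi Tabcdegfhiabcdgefhi Seh 0efbcdgh D D Xh Chi'',
  ''Tabcdefghiabcdfeghi Seh 0egbcdfh Sfh 0fgbcdeh D D Xh Chi Tabcefgdhiabcegfdhi Seh 0edbcfgh Sfh'',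
  ''0fdbcegh Sgh 0gdbcefh D D Xe Xd Xf Xg Xh Chi Tabcdefghiabcdfeghi D D Xh Chi'',
  ''Tabcdegfhiabcdgefhi Sgh 0gfbcdeh D D Xg Xf Xh Chi Tabcdegfhiabcdgefhi D D Xh Chi'',
  ''Tabcdefghiabcdfeghi Sfh 0fgbcdeh D D Xh Chi Tabcefgdhiabcegfdhi Sfh 0fdbcegh Sgh 0gdbcefh D D'',
  ''Xf Xd Xg Xh Chi Tabcdefghiabcdfeghi D D Xh Chi Tabcefgdhiabcegfdhi Sgh 0gdbcefh D D Xg Xd Xh'',
  ''Chi Tabcefgdhiabcegfdhi D D Xh Chi Tabcdefghiabcdfeghi Sdh 0dgbcefh D D Xh Chi'',
  ''Tabcdegfhiabcdgefhi Sdh 0dfbcegh Sgh 0gfbcdeh D D Xg Xd Xf Xh Chi Tabcdegfhiabcdgefhi D D Xh'',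
  ''Chi Tabcefgdhiabcegfdhi Sfh 0fdbcegh D D Xf Xd Xh Chi Tabcefgdhiabcegfdhi D D Xh Chi'',
  ''Tabcdegfhiabcdgefhi Sdh 0dfbcegh D D Xh Chi Tabcdefghiabcdfeghi Sdh 0dgbcefh Sfh 0fgbcdeh D D'',
  ''Xh Chi Tabcdfgehiabcdgfehi Sdh 0debcfgh Sfh 0febcdgh Sgh 0gebcdfh D D Xf Xd Xe Xg Xh Chi'',
  ''Tabcdefghiabcdfeghi D D Xh Chi Tabcdfgehiabcdgfehi Sgh 0gebcdfh D D Xg Xe Xh Chi'',
  ''Tabcdfgehiabcdgfehi D D Xh Chi Tabcdefghiabcdfeghi Seh 0egbcdfh D D Xh Chi Tabcefgdhiabcegfdhi'',
  ''Seh 0edbcfgh Sgh 0gdbcefh D D Xe Xd Xg Xh Chi Tabcdefghiabcdfeghi D D Xh Chi'',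
  ''Tabcefgdhiabcegfdhi Sgh 0gdbcefh D D Xg Xd Xh Chi Tabcefgdhiabcegfdhi D D Xh Chi'',
  ''Tabcdefghiabcdfeghi Sdh 0dgbcefh D D Xh Chi Tabcdfgehiabcdgfehi Sdh 0debcfgh Sgh 0gebcdfh D D'',
  ''Xg Xd Xe Xh Chi Tabcdfgehiabcdgfehi D D Xh Chi Tabcefgdhiabcegfdhi Seh 0edbcfgh D D Xe Xd Xh'',
  ''Chi Tabcefgdhiabcegfdhi D D Xh Chi Tabcdfgehiabcdgfehi Sdh 0debcfgh D D Xh Chi'',
  ''Tabcdefghiabcdfeghi Sdh 0dgbcefh Seh 0egbcdfh D D Xh Chi Tabcdegfhiabcdgefhi Sdh 0dfbcegh Seh'',
  ''0efbcdgh Sgh 0gfbcdeh D D Xg Xd Xe Xf Xh Chi Tabcdegfhiabcdgefhi D D Xh Chi'',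
  ''Tabcdfgehiabcdgfehi Sfh 0febcdgh D D Xf Xe Xh Chi Tabcdfgehiabcdgfehi D D Xh Chi'',
  ''Tabcdegfhiabcdgefhi Seh 0efbcdgh D D Xh Chi Tabcefgdhiabcegfdhi Seh 0edbcfgh Sfh 0fdbcegh D D'',
  ''Xe Xd Xf Xh Chi Tabcdegfhiabcdgefhi D D Xh Chi Tabcefgdhiabcegfdhi Sfh 0fdbcegh D D Xf Xd Xh'',
  ''Chi Tabcefgdhiabcegfdhi D D Xh Chi Tabcdegfhiabcdgefhi Sdh 0dfbcegh D D Xh Chi'',
  ''Tabcdfgehiabcdgfehi Sdh 0debcfgh Sfh 0febcdgh D D Xf Xd Xe Xh Chi Tabcdfgehiabcdgfehi D D Xh'',
  ''Chi Tabcefgdhiabcegfdhi Seh 0edbcfgh D D Xe Xd Xh Chi Tabcefgdhiabcegfdhi D D Xh Chi'',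
  ''Tabcdfgehiabcdgfehi Sdh 0debcfgh D D Xh Chi Tabcdegfhiabcdgefhi Sdh 0dfbcegh Seh 0efbcdgh D D'',
  ''Xh Chi Tabcdefghiabcdfeghi Sdh 0dgbcefh Seh 0egbcdfh Sfh 0fgbcdeh D D Xh Sdh 0dbcefgh Seh'',
  ''0ebcdfgh Sfh 0fbcdegh Sgh 0gbcdefh Xi Cij Tgcdefbhijgcdfebhij Sdi 1dbcefgih Sei 1ebcdfgih Sfi'',
  ''1fbcdegih Sgi 1gbcdefih D D D Xh Chi Tgcdefbahigcdfebahi Cgi Thabcdefgihabcdfegi Cfi'',
  ''Thabcdegfihabcdgefi Cei Thabcdfgeihabcdgfei Cdi Thabcefgdihabcegfdi Cci Thabdefgcihabdegfci'',
  ''Sdh 1dbcefgha Seh 1ebcdfgha Sfh 1fbcdegha Sgh 1gbcdefha Xb F Xd Xe Xf Xg D D Xg Xf D D D Xf Xe'',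
  ''Xg D D Xg Xe D D D Xg Xe Xf D D Xf Xe D D D D Xe Xd Xf Xg D D Xg Xf D D D Xf Xd Xg D D Xg Xd D'',
  ''D D Xg Xd Xf D D Xf Xd D D D D Xf Xd Xe Xg D D Xg Xe D D D Xe Xd Xg D D Xg Xd D D D Xg Xd Xe D'',
  ''D Xe Xd D D D D Xg Xd Xe Xf D D Xf Xe D D D Xe Xd Xf D D Xf Xd D D D Xf Xd Xe D D Xe Xd D D D'',
  ''D D D D'']"
  by code_simp

lemma no_ear2_on_clique5_cert: "refutes
    [diamond, clique ''abcdef''] (clique_with_ear ''abcde'' ''f'') [
  ''Scf Sdf Sef 1efabcd 0aebf 0adbf 0acbf'']"
  by code_simp

lemma no_ear3_on_clique5_cert: "refutes
    [square, clique_with_ear ''abcde'' ''f''] (clique_with_ear ''abcde'' ''fg'') [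
  ''Sag 1abcdeg Sbf 1bacdef 0abgf'']"
  by code_simp

lemma no_ear4_on_clique5_cert: "refutes
    [clique_with_ear ''abcde'' ''f'', clique_with_ear ''abcde'' ''fg'']
    (clique_with_ear ''abcde'' ''fgh'') [
  ''Chi Tgfacdebhigfacedbhi Cgi Thbcdeafgihbcedafgi Cfi Tghbcdeafighbcedafi Cei'',
  ''Tfghbacdeifghbadcei Cdi Tfghbacedifghbaecdi Cci Tfghbadecifghbaedci Cbi Thgfacdebihgfacedbi'',
  ''Sag 1abcdegh Sbf 0bacdef Sbg 1bacdegf Scf 0cabdef Scg 1cabdegf Sch 0cbadeh Sdf 0dabcef Sdg'',
  ''1dabcegf Sdh 0dbaceh Sef 0eabcdf Seg 1eabcdgf Seh 0ebacdh Sfh 1abcdefh Jag F Xf D Xh Xb Xc Xd'',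
  ''Xe D D Xe Xd D D D Xd Xc Xe D D Xe Xc D D D Xe Xc Xd D D Xd Xc D D D D D D'']"
  by code_simp

lemma no_pendant_clique5_cert: "refutes
    [clique_with_ear ''abcde'' ''f'', clique_with_ear ''abcde'' ''fg'',
    clique_with_ear ''abcde'' ''fgh''] (pendant_clique ''abcdef'') [
  ''Jac Xb F Xd Xe Xf F Xg Xh Xi Sfi 2fbcdeihg D D D D Xg Sfg 0febcdg Xh Chi Tabcdfeghiabcfdeghi'',
  ''Sfh 1febcdhg D D D Xf Xe F Xg Xh Xi Sei 2ebcdfihg D D D D Xg Seg 0efbcdg Xh Chi'',
  ''Tabcdefghiabcedfghi Seh 1efbcdhg D D D Xg Seg 0edbcfg Sfg 0fdbceg Xh Chi Tabcefdghiabcfedghi'',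
  ''Seh 1edbcfhg Sfh 1fdbcehg D D D Xe Xd Xf F Xg Xh Xi Sfi 2fbcdeihg D D D D Xg Sfg 0fdbceg Xh'',
  ''Chi Tabcefdghiabcfedghi Sfh 1fdbcehg D D D Xf Xd F Xg Xh Xi Sdi 2dbcefihg D D D D Xg Sdg'',
  ''0dfbceg Xh Chi Tabcdefghiabcedfghi Sdh 1dfbcehg D D D Xg Sdg 0debcfg Sfg 0febcdg Xh Chi'',
  ''Tabcdfeghiabcfdeghi Sdh 1debcfhg Sfh 1febcdhg D D D Xf Xd Xe F Xg Xh Xi Sei 2ebcdfihg D D D D'',
  ''Xg Seg 0edbcfg Xh Chi Tabcefdghiabcfedghi Seh 1edbcfhg D D D Xe Xd F Xg Xh Xi Sdi 2dbcefihg D'',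
  ''D D D Xg Sdg 0debcfg Xh Chi Tabcdfeghiabcfdeghi Sdh 1debcfhg D D D Xg Sdg 0dfbceg Seg 0efbcdg'',
  ''Xh Chi Tabcdefghiabcedfghi Sdh 1dfbcehg Seh 1efbcdhg D D D Xg Sdg 0dcbefg Seg 0ecbdfg Sfg'',
  ''0fcbdeg Xh Chi Tabdefcghiabdfecghi Sdh 1dcbefhg Seh 1ecbdfhg Sfh 1fcbdehg D D D Xg Sdg'',
  ''1dbcefga Seg 1ebcdfga Sfg 1fbcdega Xb F Xd Xe Xf F Xh Xi Sfi 1fbcdeih D D D Xh Chi'',
  ''Tgabcdfehigabcfdehi Sfh 0febcdh D D Xf Xe F Xh Xi Sei 1ebcdfih D D D Xh Chi'',
  ''Tgabcdefhigabcedfhi Seh 0efbcdh D D Xh Chi Tgabcefdhigabcfedhi Seh 0edbcfh Sfh 0fdbceh D D Xe'',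
  ''Xd Xf F Xh Xi Sfi 1fbcdeih D D D Xh Chi Tgabcefdhigabcfedhi Sfh 0fdbceh D D Xf Xd F Xh Xi Sdi'',
  ''1dbcefih D D D Xh Chi Tgabcdefhigabcedfhi Sdh 0dfbceh D D Xh Chi Tgabcdfehigabcfdehi Sdh'',
  ''0debcfh Sfh 0febcdh D D Xf Xd Xe F Xh Xi Sei 1ebcdfih D D D Xh Chi Tgabcefdhigabcfedhi Seh'',
  ''0edbcfh D D Xe Xd F Xh Xi Sdi 1dbcefih D D D Xh Chi Tgabcdfehigabcfdehi Sdh 0debcfh D D Xh Chi'',
  ''Tgabcdefhigabcedfhi Sdh 0dfbceh Seh 0efbcdh D D Xh Chi Tgabdefchigabdfechi Sdh 0dcbefh Seh'',
  ''0ecbdfh Sfh 0fcbdeh D D Xh Chi Tfcdebaghifcedbaghi Cfi Thgabcdefihgabcedfi Cei'',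
  ''Thgabcdfeihgabcfdei Cdi Thgabcefdihgabcfedi Cci Thgabdefcihgabdfeci Sdh 2dbcefhga Seh'',
  ''2ebcdfhga Sfh 2fbcdehga Xb F Xd Xe Xf D D Xf Xe D D D Xe Xd Xf D D Xf Xd D D D Xf Xd Xe D D Xe'',
  ''Xd D D D D D D D'']"
  by code_simp

lemma no_ear2_on_clique4_cert: "refutes
    [diamond, clique ''abcde''] (clique_with_ear ''abcd'' ''e'') [
  ''Sce Sde 1deabc 0adbe 0acbe'']"
  by code_simp

lemma no_ear3_on_clique4_cert: "refutes
    [square, clique_with_ear ''abcd'' ''e''] (clique_with_ear ''abcd'' ''ef'') [
  ''Saf 1abcdf Sbe 1bacde 0abfe'']"
  by code_simp

lemma no_ear4_on_clique4_cert: "refutes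
    [clique_with_ear ''abcd'' ''e'', clique_with_ear ''abcd'' ''ef'']
    (clique_with_ear ''abcd'' ''efg'') [
  ''Saf 1abcdfg Sag 0abcdg Sbe 0bacde Sbf 1bacdfe Sce 0cabde Scf 1cabdfe Scg 0cbadg Sde 0dabce Sdf'',
  ''1dabcfe Sdg 0dbacg Seg 1abcdeg Jaf F Xe Xh Chi Tfgbcdaehifgbdcaehi Cdi Thefgbacdihefgbcadi Cci'',
  ''Thefgbadcihefgbdaci Cai Thefgbcdaihefgbdcai Sbh 1bacdhe Sch 1cabdhe Sdh 1dabche Xg Cbi'',
  ''Thgfeacdbihgfeadcbi Xb F Xc Xd D D Xd Xc D D D Xi Cij Tfeacdbgijfeadcbgij D D D D Xg Xb Xc Xd'',
  ''Xh Chi Tcaefgbdhicbgfeadhi Seh 1adbceh D D Xh Chi Tdaefgbchidbgfeachi Sdh 0dcabh Seh 1acbdeh D'',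
  ''D Xd Xc Xh Chi Tdaefgbchidbgfeachi Seh 1acbdeh D D Xh Chi Tcaefgbdhicbgfeadhi Sch 0cdabh Seh'',
  ''1adbceh D D Xh Chi Tgfeacdbhigfeadcbhi Sch 0cbadh Sdh 0dbach Seh 1abcdeh D D Xh Chi'',
  ''Tfeacdbghifeadcbghi Cdi Thgfeabcdihgfeacbdi Cci Thgfeabdcihgfeadbci Cbi Thgfeacdbihgfeadcbi'',
  ''Sch 1cbadhg Sdh 1dbachg Xb Xc Xd D D Xd Xc D D D Xe Xi Cij Tfgbcdaeijfgbdcaeij D D D D Xh Chi'',
  ''Tgbcdaefhigbdcaefhi Cgi Thfeacdbgihfeadcbgi Cei Thfgbcdaeihfgbdcaei F Xb F Xc Cdi'',
  ''Thcaefgbdihcbgfeadi Xd D Xi Cij Thfeabdcijhfeadbcij D D Xd Cci Thdaefgbcihdbgfeaci Xc D Xi Cij'',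
  ''Thfeabcdijhfeacbdij D D Xe D Xg D D Xc Xb F Xd Xi Cij Thfeabcdijhfeacbdij D D Xe D Xg D D Xd'',
  ''Xb F Xe D Xg D D Xi Cij Thfeabcdijhfeacbdij Sbi 0bdaci D D Xi Cij Thfeabdcijhfeadbcij Sbi'',
  ''0bcadi Sdi 0dcabi D D Xd Xb F Xc Xi Cij Thfeabdcijhfeadbcij D D Xe D Xg D D Xc Xb F Xe D Xg D'',
  ''D Xi Cij Thfeabdcijhfeadbcij Sbi 0bcadi D D Xi Cij Thfeabcdijhfeacbdij Sbi 0bdaci Sci 0cdabi D'',
  ''D Xe D Xi Cij Tefgbcdaijefgbdcaij Sbi 0bacdi Sci 0cabdi Sdi 0dabci D D D'']"
  by code_simp

lemma no_ear5_on_clique4_cert: "refutes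
    [clique_with_ear ''abcd'' ''e'', clique_with_ear ''abcd'' ''ef'',
    clique_with_ear ''abcd'' ''efg''] (clique_with_ear ''abcd'' ''efgh'') [
  ''Chi Tgfeacdbhigfeadcbhi Cgi Thbcdaefgihbdcaefgi Cfi Tghbcdaefighbdcaefi Cei'',
  ''Tfghbcdaeifghbdcaei Cdi Tcaefghbdicbhgfeadi Cci Tdaefghbcidbhgfeaci Cbi Thgfeacdbihgfeadcbi'',
  ''Saf 2abcdfgh Sbe 0bacde Sbf 1bacdfe Sbg 2bacdgfe Sce 0cabde Scf 1cabdfe Scg 1cbadgh Sch 0cbadh'',
  ''Sde 0dabce Sdf 1dabcfe Sdg 1dbacgh Sdh 0dbach Seg 2abcdegh Seh 1abcdeh Sfh 2bacdhfe Jaf F Xe D'',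
  ''Xg Xh Xb Xc Xd D D Xd Xc D D D D D D'']"
  by code_simp

lemma no_pendant_clique4_cert: "refutes
    [clique_with_ear ''abcd'' ''e'', clique_with_ear ''abcd'' ''ef'',
    clique_with_ear ''abcd'' ''efg'', clique_with_ear ''abcd'' ''efgh'']
    (pendant_clique ''abcde'') [
  ''Jac Xb F Xd Xe F Xf Xg Xh Xi Sei 3ebcdihgf D D D D D Xf Sef 0edbcf Xg Seg 1edbcgf Xh Chi'',
  ''Tabcedfghiabecdfghi Seh 2edbchgf D D D D Xe Xd F Xf Xg Xh Xi Sdi 3dbceihgf D D D D D Xf Sdf'',
  ''0debcf Xg Sdg 1debcgf Xh Chi Tabcdefghiabdcefghi Sdh 2debchgf D D D D Xf Sdf 0dcbef Sef 0ecbdf'',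
  ''Xg Sdg 1dcbegf Seg 1ecbdgf Xh Chi Tabdecfghiabedcfghi Sdh 2dcbehgf Seh 2ecbdhgf D D D D Xf Sdf'',
  ''1dbcefa Sef 1ebcdfa Xb F Xd Xe F Xg Xh Xi Sei 2ebcdihg D D D D Xg Seg 0edbcg Xh Chi'',
  ''Tfabcedghifabecdghi Seh 1edbchg D D D Xe Xd F Xg Xh Xi Sdi 2dbceihg D D D D Xg Sdg 0debcg Xh'',
  ''Chi Tfabcdeghifabdceghi Sdh 1debchg D D D Xg Sdg 0dcbeg Seg 0ecbdg Xh Chi Tfabdecghifabedcghi'',
  ''Sdh 1dcbehg Seh 1ecbdhg D D D Xg Sdg 2dbcegfa Seg 2ebcdgfa Xb F Xd Xe F Xh Xi Sei 1ebcdih D D'',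
  ''D Xh Chi Tgfabcedhigfabecdhi Seh 0edbch D D Xe Xd F Xh Xi Sdi 1dbceih D D D Xh Chi'',
  ''Tgfabcdehigfabdcehi Sdh 0debch D D Xh Chi Tgfabdechigfabedchi Sdh 0dcbeh Seh 0ecbdh D D Xh Chi'',
  ''Tecdbafghiedcbafghi Cei Thgfabcdeihgfabdcei Cdi Thgfabcedihgfabecdi Cci Thgfabdecihgfabedci'',
  ''Sdh 3dbcehgfa Seh 3ebcdhgfa Xb F Xd Xe D D Xe Xd D D D D D D D'']"
  by code_simp

text \<open>Depending on its chords, a four-cycle is induced, a diamond or a clique.\<close>

lemma no_cycle4_cert: "refutes [diamond, square, clique ''abcd''] (cycle ''abcd'') [
  ''Sac Sbd 2bdac 0abcd Sbd 0badc 1abcd'']"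
  by code_simp

text \<open>Stepping stones for the triangle. A triangle and a cycle of length \<open>q\<close> that share an edge are the same
as a cycle of length \<open>q + 1\<close> with a chord between vertices at distance two. A path through this chord
that avoids the third vertex of the triangle has a variant that is longer by one.\<close>

lemma no_glued35_cert: "refutes [cycle ''abcd''] (glued_cycles ''c'' ''def'') [
  ''Sae 0aefb Saf 0afbc Sbd 0bdac Sbe 0beda Scd 0cdab Sce 0ceda Scf 0cfba Sdf 0dfba Jae Xb Xc Xg'',
  ''Sdg 0dgca Sfg 0fgcb Xh Xd Xi Sfi 0fide Xj Sej Nejidhgcbf D D D Xf Xi Sdi 0dife Xj Sej'',
  ''Nejifhgcad D D D Xi Cij Tedabcghijefbacghij Sdi Ndihgcabfe Sfi Nfihgcbade D D D D Xf Xg Scg'',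
  ''0cgfb Sdg 0dgfe Xh Xc Xi Sdi 0dica Xj Sej Thgfbadejihgfedabci D D D Xd Cei Tcabfghdeicbadhgfei'',
  ''F D Xi Sci Ncihgfedab Sdi Tcabfghidecbadihgfe Xj Cjk Tacbfghijkadefghijk Scj Ncjihgfeda Sdj'',
  ''Ndjihgfbca D D D D D Xg Scg 0cgba Sdg 0dgba Xf Xh Sch 0chfb Sdh 0dhfe F Xd Xi F Xj Sij'',
  ''Nijhfgbcad D D D Xi Chj Tiedabgfhjiedacbfhj F D D D Xh Sch 0chgb Sfh 0fhgb Xd Xi Sci 0cida Sfi'',
  ''0fide Xj Cek Tjidacbfekjidhgbfek Sfj Tgbcadefjighdacbfji F Xf F D D D D Xi Sci Ncihgbfeda Sfi'',
  ''Nfihgbcade Xd Cfj Tcadihgbfjcbghidefj Cej Tacbghidejadihgbfej F Xf D D Xj Cjk'',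
  ''Tdacbghijkdefbghijk Scj Tedabcjihgefbacjihg Sdj Tacbghijdeadjihgbfe Sfj Nfjihgbade D D D D D'',
  ''Xc Xb Xf Xg Sdg 0dgfe Xh Xd Cei Tcabfghdeicbadhgfei F D Xi Sdi Tcabfghidecbadihgfe Xj Sej'',
  ''Nejihgfbad D D D D D Xg Sag 0agbc Scg 0cgba Sdg 0dgba Seg 0egbf Xf Xh Sah 0ahfb Sbh 0bhfg Sch'',
  ''0chfb Sdh 0dhfe Sgh 0ghfb Xi Cij Tedabgfhijedacbfhij Cej Tihfbcadejihfgbadej Sbi 0bihf Sci'',
  ''Tedabcihfgedacihfbg Seh Tgbcadefhigfbcadehi Sei Neihfgbcad Sgi Ngihfedacb Xd Chj'',
  ''Tedacbgfhjefbcadihj Cgj Thfedacbgjhidacbfgj Ccj Tidefgbacjihfedabcj Caj Thidefbcajhidefgbaj'',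
  ''Sai Tediacbgfhefgbcadih Sfi 0fide Jdh F Xf F Xa F Xb F Xc D D Xe D Xg Xb F Xc D D D Xj Cjk'',
  ''Thidabgfjkhidacbfjk Sbj 0bjfg D D Xe D Xi D Xj Cjk Tihfbcadjkihfgbadjk Sbj 0bjda D D Xi D D D'',
  ''D D Xh Sfh 0fhgb Xd Xi Sfi 0fide Xj Sej 0ejid D D D Xi Sfi Nfihgbcade Xd Cej'',
  ''Tacbghidejadihgbfej Xj D D Xj Cjk Tdacbghijkdefbghijk Sdj Tacbghijdeadjihgbfe Sfj Nfjihgbade D'',
  ''D D D D Xg Sbg 0bgca Sdg 0dgca Sfg 0fgcb Xh Sbh 0bhgc Xd Xi Sbi 0bida Sfi 0fide Xj Cjk'',
  ''Tabcghdijkacbfedijk Sfj Nfjidhgcab F Xf F D Xk F D D D D Xf F Xd Xi Cij Tgcabfedijghfbcadij'',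
  ''Sbi Nbidefhgca D D Xi Cij Thfbcadeijhgcabfeij Sbi Nbiedacghf Sdi Ndiefhgcba D D Xi Cij'',
  ''Tedabcghijefbacghij Sbi Nbihgcadef Sdi Ndihgcabfe Sfi Nfihgcbade D D D D Xd Xg Sbg 0bgda Scg'',
  ''0cgda Sfg 0fgde Xh F Xf Xb F Xc Xi Sbi 0bica D D Xi Sci Ncihgdefba Xj Sbj Tcadghijbfcbjihgdef'',
  ''D D D Xi Sci 0cifb Xb Chj Tefbcadghjefibadghj Sch Nchgdefiba F D Xj Sbj 0bjif Scj'',
  ''Thgdacbfijhgdefbacj Xk Shk Nhkjifbadg F D D D D Xi Sbi 0bief Sci Thgdacbfeihgdefbaci Sfh'',
  ''Tcabfhgdeicbadghfei Xf Chj Tefbcadghjeifbadghj Sbh Tcabhgdeficadghbfei Sch Nchgdeifba F D Xj'',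
  ''Sbh Tgdacbfeijghbcadeij Sch Tgdacbfeijghcabfeij Scj Thgdabfeijhgdefbacj Sfj 0fjie F Xk Sbj'',
  ''Tabjiedghkacbfedghk F Xl Skl Tcabfedghkcabfeijlk F D D D D D D D Xg Sbg 0bgac Scg 0cgab Sfg'',
  ''0fgab Xd Xh Sbh 0bhda Sch 0chda Sfh 0fhde Xi Cij Tefbagdhijefbcadhij Cej Tihdacbfejihdgabfej'',
  ''Sci Tefbacihdgefbcihdag F Xf F Xb Cfj Thibagdefjhibcadefj F D D D D D Xh Sbh 0bhga Sch 0chga'',
  ''Sdh 0dhga Xf F Xd Xi Cij Tgacbfedijghfbcadij Sbi Nbidefhgac Sci Ncidefhgab D D Xi Cij'',
  ''Thfbcadeijhgacbfeij Sbi 0bief Sci Nciedaghfb Sdi Tcbaghfedicbfhgadei D D Xi Sci Ncihgadefb Sdi'',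
  ''Ndihgacbfe Xb Cej Tcaghibfejcbihgadej Ccj Thgadefbcjhibfedacj F Xd Xj Cjk Tgacbfedjkghibcadjk'',
  ''Sfj 0fjde D D Xf F Xc D Xj F Xk Sjk 0jkfb F D D D D Xf Cej Tbcaghifejbfihgadej Cdj'',
  ''Tcaghifedjcbfihgadj F Xd D D Xj Cjk Tfbcaghijkfedaghijk Sbj Nbjihgadef Scj Tedabcjihgefbacjihg'',
  ''Sdj Ndjihgabfe Sfj Tbcaghijfebfjihgade D D D D D'']"
  by code_simp

lemma no_glued36_cert: "refutes
    [cycle ''abcd'', glued_cycles ''c'' ''def''] (glued_cycles ''c'' ''defg'') [
  ''Sae 1aedbgf Saf 0afgb Sag 0agbc Sbd 0bdac Sbe 0beda Sbf 1bfgade Scd 0cdab Sce 0ceda Scf 0cfgb'',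
  ''Scg 0cgba Sdf 1dfeabg Sdg 0dgba Seg 1egfdab Jag F Xb Xc Xh Sah 0ahcb Sbh 0bhca Sdh 0dhca Seh'',
  ''1cabhed Sfh 1cbahfg Sgh 0ghcb Xi Sai Naihcbgfed Sbi Nbihcadefg Sdi Ndihcabgfe Sgi Ngihcbadef'',
  ''Xe Cdj Thcabgfedjhiefgbadj Caj Thcbgfedajhiefgbcaj F Xd D D Xf Cij Tedacbgfijefgbachij Chj'',
  ''Tgbadefihjgfedabchj Cgj Thcbadefgjhifedabgj Cej Tifgbcadejihcabgfej Cdj Thcabgfedjhifgbcadj'',
  ''Cbj Thcadefgbjhifedacbj Sci 1cihbgf Sei Tgbcadefihgfiedabch Jci F Xf Xe Xd Xa Xb Xg D D Xj Cjk'',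
  ''Tdefgbcajkdefihcajk D D D D Xg Xb Xa F Xh D Xj Cjk Thifedacjkhifgbacjk D D D D Xj Cjk'',
  ''Tihcabgfjkihcadefjk Saj 1abcjfg D D Xh D D Xj Cjk Tfedachijkfgbachijk Sdj Ndjihcbgfe Sej'',
  ''Nejihcabgf Sfj Nfjihcbade D D D D Xh Sch 0chba Sdh 0dhba Seh 1bached Sfh 0fhbg Xi Sci'',
  ''Ncihbgfeda Sdi 1abcdih Xe Cfj Tiedacbgfjihbcadefj Ccj Thbgfedacjhiefgbacj F Xc D Xd Xj Cjk'',
  ''Tefgbcadjkeihbcadjk D D Xj Cjk Tdefgbcajkdeihbcajk Sdj Tdacbgfeihdjabgfeih D D Xf Ccj'',
  ''Thbgfedacjhifedabcj Xe Xd Xj Saj Najdefihbc F D D Xj Cjk Tfgbcadejkfihbadejk Sdj Ndjefihbca D'',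
  ''D Xj Cjk Tedabhifjkedacbgfjk Sdj 0djfe Sej Nejfihbcad D D Xj Scj 1cbajih Sdj'',
  ''Tcabhijdefcadjihbgf Sej Tcabhijefgcadejihbg Sfj Nfjihbcade Xk Ckl Tedabhijklefgbhijkl Sck'',
  ''Tckjihbadeckjihbgfe Sdk Ndkjihbgfe Sek Nekjihbcad Sfk Nfkjihbade D D D D D Xf Xe Xd Xh Sbh'',
  ''0bhda Sch 0chda Xi Sbi 1bacihd Sci Ncihdefgba Xj Sbj Tcabjihdefcadhijbgf Scj Ncjihdefgb Xk Sak'',
  ''Tefgbcadhiefgbcakji F D D D D D Xh Sbh 1bached Sch 1cabhed Xd Xi Cij Tabgfehdijacbgfedij Sbi'',
  ''0bida Sci Ncidhefgba D D Xi Sdi Ndihefgbca Xb Ccj Tibgfedacjihefgbacj Xc D Xj Cjk'',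
  ''Tcadefgbjkcadehibjk Sdj 0djba D D Xc Cdj Ticabgfedjihefgbadj Caj Ticbgfedajihefgbcaj F Xb Xj'',
  ''Scj 0cjba D D Xd D D Xj Cjk Tcbadehijkcbgfehijk Sbj Tcabjihefgcadehijbg Scj Ncjihefgba Sdj'',
  ''Ndjihefgba D D D D Xh Sbh 0bhfg Sch 1cbahfg Sdh 0dhfe Xe Xd Xi Cij Tefgbcadijehfgbadij Sbi'',
  ''0bida Sci Ncidehfgba D D Xi Cij Tdabgfheijdacbgfeij Sbi 1bacied Sci 1cabied Sdi Ndiehfgbca D D'',
  ''Xi Sei Neihfgbcad Xb Ccj Tibgfedacjihfedabcj Xc D Xj Sdj 0djba Sej 1bacjed Xk Sdk 1abcdkj F Xc'',
  ''D Xd D Xl Skl Nkladefgbj D D D D Xc Cej Thfgbcadejhicabgfej Cdj Ticabgfedjihfgbcadj Cbj'',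
  ''Ticadefgbjihfedacbj Xb D Xj Cjk Tihfedacjkihfgbacjk D D Xd Cej Thfgbcadejhidabgfej Ccj'',
  ''Tidefgbacjihfedabcj Xe D Xj Cjk Tabgfhidjkacbgfedjk Sbj 0bjda D D Xj Cjk Tcabgfhijkcadefhijk'',
  ''Sbj Nbjihfedac Scj Ncjihfedab Sdj Ndjihfgbca Sej Nejihfgbad D D D D Xh Sch 0chgb Sdh 1abcdhg'',
  ''Seh 0ehgf Xb Cci Thbgfedacihgfedabci Xc D Xi Sdi 0diba Sei 1bacied Sfi 0fibg Xj Sdj 1abcdji'',
  ''Sej Tfgbcadejifghbadeji Sfj 1gbhfji Xk Ckl Tedacbijklefghbijkl Sdk Ndkjibhgfe Sek'',
  ''Thbcadekjihgbadekji Sfk Nfkjibcade D D D D Xf Xe Xd Xi Cij Tefgbcadijefhgbadij Sbi 0bida Sci'',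
  ''Ncidefhgba D D Xi Cij Tfgbcadeijfhgbadeij Sbi 1bacied Sci 1cabied Sdi Ndiefhgbca D D Xi Cij'',
  ''Tedabghfijedacbgfij Sbi 0bifg Sci 1cbaifg Sdi 0dife Sei Neifhgbcad D D Xi Sbi Nbihgfedac Sci'',
  ''Ncihgfedab Sfi Nfihgbcade Xd Cfj Thgbcadefjhidacbgfj Cej Tidacbgfejihgbcadej Ccj'',
  ''Tidefgbacjihgfedacj Xe Xf D D Xj Cjk Tcabgfedjkcabghidjk Sbj 0bjda D D Xe Cfj'',
  ''Thgbcadefjhiedabgfj Ccj Tfeihgbacjfghiedacj Xd Xj Cjk Tefgbcadjkeihgbadjk Sbj 0bjda D D Xf D'',
  ''Xj Cjk Tdabghiejkdacbgfejk Sbj 1bacjed Sdj Ndjeihgbca D D Xj Sbj Nbjihgfeda Scj Ncjihgfeda Sdj'',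
  ''Tcabghijdecadjihgfe Sej Nejihgbcad Sfj Nfjihgbade Xk Ckl Tdabghijkldefghijkl Sbk'',
  ''Tfedacbghifedacbkji Sck Tckjihgbadckjihgfed Sdk Ndkjihgbca Sek Nekjihgbad Sfk'',
  ''Tcbadefghicbadefkji D D D D D'']"
  by code_simp

lemma no_glued57_cert: "refutes
    [cycle ''abcd'', glued_cycles ''c'' ''def''] (glued_cycles ''cde'' ''fghij'') [
  ''Sac 0acde Sbd Nbdeafghij Sbe 0bedc Sbf 1abfedc Sbg 0bgfa Sbh 0bhij Sbi Nbihgfaedc Sce'',
  ''Nceafghijb Scf 0cfab Scg Ncghijbaed Sch Tdcbafghijdeafghcbj Sci 0cijb Scj Ncjihgfaed Sdf'',
  ''Ndfghijbae Sdg Tcbjihgfaecdghijbae Sdh Tcdeabjihgcdhijbafg Sdi Tcdeafghijcdihgfabj Sdj'',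
  ''Ndjihgfabc Sef Nefghijbcd Seg 0egfa Seh Tdcbjiheafdeabjihgf Sei Neihgfabcd Sej 0ejba Sfh'',
  ''Nfhijbcdea Sfi 0fihg Sfj 0fjba Sgi Ngijbcdeaf Sgj 0gjih Shj Nhjbcdeafg Jac F Xb Xj Xi Xh Xg Xf'',
  ''Xk Sak Tcbakfghijcdeafghij F D D Xk Ckl Teabjihgkledcbafgkl Sdk Ndkghijbae Sek Nekghijbcd Sfk'',
  ''Teabjihgkfedcbjihgf D D Xk Ckl Tdcbafghkldeabjihkl Sdk Tcbaedkhijcdeafghij Sek Nekhgfabcd Sfk'',
  ''0fkhg Sgk Teabjihkgfedcbjihgf D D Xk Ckl Tcbafghiklcdeabjikl Sdk Ndkihgfabc Sek'',
  ''Tcbafghikecbjihgfae Sfk Nfkijbcdea Sgk 0gkih Shk Teabjikhgfedcbjihgf D D Xk Sdk Ndkjihgfae Sek'',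
  ''Tedcbafghiekjbafghi Sfk Tcbafkjihgcdeabjihg Sgk Ngkjbcdeaf Shk 0hkji Sik Teabjkihgfedcbjihgf'',
  ''Xl Clm Taedcbjklmafghijklm Sdl Tafghijbcdafghijkld Sel Nelkjihgfa Sfl Nflkjbcdea Sgl'',
  ''Tcdeabjihgcdeabjklg Shl Teabjklhgfedcbjihgf Sil Nilkjbafgh D D D Xk Sdk 0dkbc Sek Nekbjihgfa'',
  ''Sfk 0fkba Sgk Tcdeafghijcdeafgkbj Shk Nhkbcdeafg Sik 0ikbj Sjk Teabkjihgfedcbjihgf Xl Clm'',
  ''Tfaedcbklmfghijbklm Sdl Tdeabjihgfdlkbjihgf Sel Tedcbafghielkbafghi Sfl Taedcbjihgaedcbklfg'',
  ''Sgl Nglkbcdeaf Shl Tfaedcbjihfaedcbklh Sil Teabklihgfedcbjihgf Sjl Njlkbafghi D D D Xd Xe Xk'',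
  ''Ckl Tgfabcdeklghijbaekl Sbk Nbkeafghij Sfk Nfkeabjihg Sgk Ngkedcbjih Shk Nhkedcbafg Sik'',
  ''Tgfabcdekigfaedcbji Sjk Tbcdeafghibjkeafghi D D Xk Ckl Thgfabcdklhijbaedkl Sbk 0bkdc Sek'',
  ''1dekcba Sfk Nfkdcbjihg Sgk Ngkdeabjih Shk Tgfabcdkhigfaedcbji Sik Nikdcbafgh Sjk Njkdeafghi D'',
  ''D Xk Ckl Tihgfabcklijbaedckl Sbk 1cbkdea Sdk 1cdkbae Sek 0ekcd Sfk Taedcbjihgafkcbjihg Sgk'',
  ''Tgfaedcbjigkcdeabji Shk Nhkcdeabji Sik Nikcdeafgh Sjk Njkcbafghi D D'']"
  by code_simp

lemma no_glued37_cert: "refutes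
    [cycle ''abcd'', glued_cycles ''c'' ''def'', glued_cycles ''c'' ''defg'',
    glued_cycles ''cde'' ''fghij''] (glued_cycles ''c'' ''defgh'') [
  ''Sae 2aedbhgf Sbd 0bdac Sbe 0beda Sbf 0bfgh Sbg 2bghadef Scd 0cdab Sce 0ceda Scf 1cabfed Scg'',
  ''0cghb Sch 0chba Sdf 2dfeabhg Sdg 0dgfe Sdh 0dhba Seg 2egfdabh Seh 0ehgf Sfh 2fhgedab Jae F Xd'',
  ''Xi Sbi 0bida Sci Ncidefghba Sfi 0fide Sgi 2bachgid Shi 1bachid Xj Sbj 1bacjid Scj Ncjidefghb'',
  ''Sfj Nfjidacbhg Sgj Tcabhgfedicbadefgji Shj 2bachjid Xk Ckl Thbcadijklhgfedijkl Sbk Nbkjidefgh'',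
  ''Sck 2cabkjid Sfk Nfkjidabhg Sgk Ngkjidacbh Shk Tedacbhkjiefghbcadi D D D D Xf Xg Xh Xb Xc Xi'',
  ''Sdi Ndicabhgfe Xj Saj 0ajic F D D D Xi Sci Ncibhgfeda Sdi 0diba Xj Scj 0cjib Sdj 1abcdji Xk'',
  ''Sak 1abckji F D D D D Xi Sbi Nbihgfedac Sci Ncihgfedab Sdi 1abcdih Xj Sbj Nbjihgfeda Scj'',
  ''Ncjihgfeda Sdj 2abcdjih Xk Ckl Tdacbhijkldefghijkl Sbk 3hbkjigfeda Sck 2cbakjih Sdk'',
  ''Tgfedacbhighbcadkji D D D D Xi Sbi 0bigh Sci 1cbaigh Sdi 2abcdigh Shi Nhigfedacb Xj Sbj'',
  ''Nbjigfedac Scj Ncjigfedab Sdj Tfedacbhgifghbcadji Shj Nhjigfedab Xk Ckl Tacbhgijkladefgijkl'',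
  ''Sbk Nbkjigfeda Sck Nckjigfeda Sdk Ndkjighbca Shk 3ghkjifedab D D D D Xi Sbi 2bacifed Sci'',
  ''2cabifed Sdi 0dife Sgi Ngifedacbh Shi 0hifg Xj Cjk Tcabhgfijkcbadefijk Sbj Tgfedacbjighbcadefi'',
  ''Scj Tedacbhgfiefghbacji Sdj Ndjifghbca Sgj Ngjifedabh Shj Nhjifedacb D D D Xi Sbi 1bacied Sci'',
  ''1cabied Sdi Ndiefghbca Sfi Nfiedacbhg Sgi 0gief Shi 2bachied Xj Sbj 2bacjied Scj Ncjiefghba'',
  ''Sdj Ndjiefghba Sfj Nfjiedabhg Sgj Ngjiedacbh Shj Tfedacbhjifghbcadei Xk Ckl'',
  ''Tbcadeijklbhgfeijkl Sbk Tfedacbkjifghbcadei Sck Nckjiefghb Sdk 3edkjifghba Sfk 3efkjidabhg Sgk'',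
  ''Ngkjiedabh Shk Nhkjiedacb D D D D'']"
  by code_simp

lemma no_glued55_cert: "refutes
    [cycle ''abcd'', glued_cycles ''c'' ''def'', glued_cycles ''cde'' ''fghij'']
    (glued_cycles ''cde'' ''fgh'') [
  ''Sac 0acde Sad 0adcb Sag 0aghb Sah 0ahgf Sbe 0bedc Sbf 0bfgh Sbg 0bgfa Sce 0ceab Scf 0cfab Scg'',
  ''0cghb Sch 1bchaed Sdf 0dfae Sdh 0dhbc Sef 1aefbcd Seg 0egfa Seh 0ehba Sfh 0fhba Jbg F Xd Chi'',
  ''Teafgdcbhiedcbafghi Cfi Tcbhgdeaficdeabhgfi Cei Thbcdgfaeihgfabcdei Cci Tfaedghbcifghbaedci Xc'',
  ''D Xe Xa Xf D Xi Xj Cjk Thbcdeaijkhgdcbaijk D D D D Xi Sai 0aide Xj Cjk Tgfabcdijkghbaedijk Saj'',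
  ''Najidcbhgf D D D Xf Xa Xe Xd Xc Xi Shi 0hicb Xj Sbj 0bjic F D D D Xi Sci Ncideafghb Shi'',
  ''Teafghbcdiedcbafghi Xj Cjk Tgfabcdijkghbaedijk Scj 0cjid Shj Nhjidcbafg D D D Xi Sci 0cied Sdi'',
  ''Ndieafghbc Shi Nhiedcbafg Xj Cjk Tfabcdeijkfghbaeijk Scj Ncjieafghb Sdj 0djie Shj 2hbafgjiedc'',
  ''D D D Xi Sci 0ciab Sdi 0diae Sei Neiafghbcd Shi 0hiab Xj Scj Teafghbcjiedcbhgfai Sdj'',
  ''Ndjiafghbc Sej 0ejia Shj Tfaedcbhjifghbcdeai Xk Ckl Tbcdeaijklbhgfaijkl Sck Nckjiafghb Sdk'',
  ''2bafghcdkji Sek Tfabcdekjifghbaekji Shk Nhkjiaedcb D D D D Xi Sai Naifghbcde Sci Ncifghbaed'',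
  ''Sdi Tcbhgfaedicdeabhgfi Sei 0eifa Shi 0hifg Xj Cjk Teabhgfijkedcbafijk Saj 0ajif Scj'',
  ''2cbaedjifgh Sdj Ndjifghbae Sej Nejifghbcd Shj Nhjifaedcb D D D Xh Xi Sai 0aihb Sci 0cihb Sdi'',
  ''Teafghbcdiedcbafghi Sei Neihgfabcd Sfi 0fihg Xj Cjk Tcbafghijkcdeabhijk Saj'',
  ''Tgfaedcbhighbcdeaji Scj Ncjihgfaed Sdj Ndjihgfabc Sej 2eabcdjihgf Sfj Nfjihbcdea D D D Xi Sai'',
  ''0aigf Sci Tfaedcbhgifghbaedci Sei Thbcdeafgihgfabcdei Sfi Nfighbcdea Shi Nhigfaedcb Xd Chj'',
  ''Teabcdighjedcbafghj Cfj Tcbaedigfjcdeabhgfj Cej Thbafgidejhgfabcdej Ccj Tfabhgidcjfghbaedcj'',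
  ''Cbj Tideafghbjigfaedcbj Caj Tidcbhgfajighbcdeaj F Xa Xe D Xf D D Xc D Xh D D Xj Cjk'',
  ''Tdcbafgijkdeabhgijk Saj Najighbcde Scj Ncjighbaed Sdj Thbcdeafgihgfabcdji Sej Nejigfabcd Sfj'',
  ''0fjig Shj 0hjig D D D'']"
  by code_simp

text \<open>The case \<open>m = 3\<close>, which is the longest one. The cycles glued together above occur in many of its branches,
which is why they are excluded beforehand.\<close>

lemma no_pendant_clique3_cert: "refutes
    [cycle ''abcd'', glued_cycles ''c'' ''def'', glued_cycles ''c'' ''defg'',
    glued_cycles ''cde'' ''fghij'', glued_cycles ''c'' ''defgh'', glued_cycles ''cde'' ''fgh'']
    (pendant_clique ''abcd'') [
  ''Jac Xb Xd Xe Xf Xg Xh Xi Sci 4cdbihgfe D D D D D D Xe Sde 0debc Xf Sdf 0dfeb Xg Sdg 1dbcgfe Xh'',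
  ''Sdh 2dbchgfe Xi Sdi 4dbcihgfe Xj Scj Ncjihgfebd D D D D D D D Xe Sce 0ceab Sde 0deab Xb Xd Xf'',
  ''Xg Xh Xi Sci 2cdbihgf D D D D D Xf Sdf 0dfbc Xg Sdg 0dgfb Xh Sdh 1dbchgf Xi Sdi 2dbcihgf Xj'',
  ''Scj 4cbdjihgf D D D D D D Xf Sbf 0bfea Scf 1cbdfea Sdf 1dbcfea Xg Sag 0agfe Scg 2cbdgfea Sdg'',
  ''2dbcgfea Xb Xd Xh Xi Sci 0cihd D D D Xh Sdh 0dhbc Xi Sdi 0dihb Xj Scj 1cbdjih D D D D Xh Sch'',
  ''4cbdhgfea Sdh 4dbchgfea Seh 0ehgf Xb Xd Xi Sci 0cidb D D Xi Sdi 0dibc Xj Scj 0cjib D D D Xi'',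
  ''Sci Ncihgfeabd Sdi Ndihgfeabc Sfi 0fihg Xb Saf 2afebihg Sah 0ahib Sai 2aibefgh Sbe 2beaihgf'',
  ''Sbg 0bghi Sbh 2bhiaefg Seg 2egfabih Sei 0eiba Sfh 2fhgeabi Sgi 2gihfeab Jaf F Xe Xj Sbj 0bjea'',
  ''Scj Ncjefghibd Sdj Ndjefghibc Sgj 0gjef Shj Tdcbaefghjdcbihgfej Sij Tcbaefghijcdbihgfej Xk Sbk'',
  ''Tcbkjefghicdbaefghi Sck Nckjefghib Sdk Ndkjefghib Sgk Tdcbaefgkjdcbihgfej Shk'',
  ''Tcbaefghkjcdbihgfej Sik Tdbikjefghdcbaejkih Xl Sbl Nblkjefghi Scl 4cbdlkjea Sdl 4dbclkjea Sgl'',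
  ''Nglkjeabih Shl Tcbaefghlkcbihgfejk Sil Tdcbaefghidcbaejkli Xm Sbm Taefghibcdaejklmbcd Scm'',
  ''Ncmlkjeabd Sdm Ndmlkjeabc Sgm Tcbaefgmlkcbihgfejk Shm Nhmlkjeabi Sim Nimlkjefgh Xn Sbn'',
  ''Tihgfeabnmihgfejklm F Xb D Xo Sno Tihgfeaonmihgfejklm D D D D D D D Xg Xh Xi Xb F Xe Xj Scj'',
  ''Ncjefghibd Sdj Ndjefghibc Xk Sbk Tcbkjefghicdbaefghi D D D Xj Scj Ncjaefghib Sdj Ndjaefghib'',
  ''Sej 4aejbihgf Xk Sck 1cbdkja Sdk 1dbckja Sek Nekjabihgf Xl Sbl 3ablkjefghi D D D D Xj Sbj'',
  ''4ibjhgfea Scj Ncjihgfeab Sdj Ndjihgfeab Sej Tdbaefghijdcbihgfej Xk Sbk Nbkjihgfea Sck 1cbdkji'',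
  ''Sdk 1dbckji Sek Tdbaekjihgdcbijkefg Xl Sbl 3iblkjhgfea Sel Taefghibcdaelkjibcd F Xb D Xe D Xm'',
  ''Slm Tdcbaefghidcbamlkji D D D D D Xj Sbj 0bjhi Scj Ncjhgfeabd Sdj Ndjhgfeabc Sej'',
  ''Tdcbaefghjdcbihgfej Sij 4hijgfeab Xk Sbk Taefghibdcaefghjkbc Sck Nckjhgfeab Sdk Ndkjhgfeab Sek'',
  ''Taefghibcdaekjhibcd Sik Nikjhgfeab Xl Sbl Nblkjhgfea Scl 4cbdlkjhi Sdl 4dbclkjhi Sel'',
  ''Taefghibdcaelkjhibc Sil 3hilkjgfeab Xm Sbm Tdcbaefghidcbmlkjhi Sem Nemlkjhiba F Xb D Xe D Xn'',
  ''Smn Nmnabihjkl D D D D D D Xj Scj 2cbdjghi Sdj 2dbcjghi Sej 0ejgf Shj 4ghjfeabi Sij 0ijgh Xb'',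
  ''Cdk Taefghibdkaefgjbcdk Cck Taefghibckaefgjbdck Cak Tdbihgfeakdcbjgfeak F Xe Xk Ckl'',
  ''Tjbihgfekljghibaekl Shk 5ghkefjbi Sik 5bikeajgh D D D Xk Ckl Tdbaefgjkldcbihgjkl Sbk'',
  ''Taefghibcdaefgjkbcd Sck Nckjgfeabd Sdk Ndkjgfeabc Sek Taefghibdcaekjghibc Shk Nhkjgfeabi Sik'',
  ''Tcbaefgjkicdbaefghi D D D Xj Scj 2cbdjfea Sdj 2dbcjfea Sej 4fejghiba Sgj 4fgjeabih Shj 0hjfg'',
  ''Xb Cik Tdbaefghikdcbjfghik Cdk Tihgfeabdkihgfjbcdk Cck Tihgfeabckihgfjbdck F Xe Xk Sgk 0gkef'',
  ''Shk 5fekhgjba Xl Clm Tgfjbaeklmghibaeklm Sgl Nglkefjbih Shl Nhlkeabjfg D D D Xk Sek 1aekbjf'',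
  ''Sgk Ngkaefjbih Shk 5bakhijfe Xl Clm Tibjfeaklmihgfeaklm Sel Nelkabihgf Sgl 3abjfeklghi Shl'',
  ''Nhlkaefjbi D D D Xi Cik Tdbaefghikdcbaefjik Chk Tdbaefjihkdcbaefghk Cdk Thgfeabcdkhgfjibcdk'',
  ''Cck Thgfeabdckhgfjibdck Cak Tdbihgfeakdcbijfeak F Xb F Xh Xg Xk Ckl Tdcbaefgkldcbijfgkl Sek'',
  ''0ekgf D D D D Xe Xk Ckl Tdbihgfekldcbijfekl Sbk 0bkea Sgk 0gkef D D D Xk Ckl'',
  ''Tcbihgfjklcdbaefjkl Sbk Tdcbaefghidcbkjfghi Sck Nckjfghibd Sdk Ndkjfghibc Sek Nekjfghiba Sgk'',
  ''Ngkjfeabih Shk Tdcbaefghkdcbihgfjk Sik Tdcbaefghidcbaefjki D D D Xj Saf Tdbaefghijdcbafghij'',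
  ''Sbe Tdbaefghijdcbefghij Scj Ncjihgfeab Sdj Ndjihgfeab Seg Tdbaefghijdcbaeghij Sfh'',
  ''Tdbaefghijdcbaefhij Sgi Tdbaefghijdcbaefgij Sgj 0gjih Shj Tcbaefghjicdbaefghi Xb Sah 5ahijbefg'',
  ''Sai 0aijb Saj 4ajbefghi Sbg 5bgfeajih Sbh 0bhij Sbi 4bijaefgh Sei 5eijbafgh Sej 0ejba Sfj'',
  ''5fjbaeghi Jaf F Xe Xk Sbk 0bkea Sck Nckefghijb Sdk Ndkefghijb Sgk 0gkef Shk'',
  ''Tdbjihgfekdcbaefghk Sik Tcbaefghikcbjihgfek Sjk Tcbjkefghicdbaefghi Xl Sbl Nblkefghij Scl'',
  ''2cbdlkea Sdl 2dbclkea Sgl Nglkeabjih Shl Tcbaefghlkcbjihgfek Sil Tdbaefghijdcbaeklij Sjl'',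
  ''Tdcbaefghidcbaeklji Xm Cmn Tihgfeklmnijbaeklmn Sbm Tjihgfeabmjihgfeklm Scm 4cbdmlkea Sdm'',
  ''4dbcmlkea Sgm Tcbaefgmlkcbjihgfek Shm Nhmlkeabji Sim Tdcbaefghidcbaeklmi Sjm Njmlkefghi D D D'',
  ''D Xg Xh Xi Xj Xb F Xe Xk Sbk 0bkea D D Xk Sck 0ckab Sdk 0dkab Sek Nekabjihgf Xl Sbl 0blka D D'',
  ''D Xk Sbk Nbkjihgfea Sck 0ckjb Sdk 0dkjb Sek Tdcbaekjihdcbjkefgh Xl Sbl 0blkj Sel'',
  ''Tdcbaefghidcbaelkji F Xb D Xe D Xm Slm Tihgfeabjkihgfeamlk D D D D Xk Sbk 0bkij Sck Nckihgfeab'',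
  ''Sdk Ndkihgfeab Sek Tdcbaekihgdcbjikefg Sjk Njkihgfeab Xl Sbl Nblkihgfea Scl 2cbdlkij Sdl'',
  ''2dbclkij Sel Taefghijbdaelkijbcd Sjl 0jlki Xm Cmn Teabjiklmnefghiklmn Sbm Thgfeabjikhgfeabmlk'',
  ''Sem Tdcbjihgfedcbjiklme F Xb D Xe D Xn D D D D D Xk Sbk Taefghijbdaefghkbcd Sck Nckhgfeabd Sdk'',
  ''Ndkhgfeabc Sek Taefghijbdaekhijbcd Sik Nikhgfeabj Sjk 0jkhi Xl Sbl Tihgfeablkijbaefghk Scl'',
  ''Nclkhgfeab Sdl Ndlkhgfeab Sel Tdcbjihgfedcbjihkle Sil 0ilkh Sjl Njlkhgfeab Xm Cmn'',
  ''Tabjihklmnaefghklmn Sbm Nbmlkhgfea Scm Ncmlkhijbd Sdm Ndmlkhijbc Sem Nemlkhijba Sim'',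
  ''Tcbaefghimcdbjihklm Sjm Tgfeabjihkgfeabjmlk D D D D Xk Ckl Tdcbaefgkldcbjihgkl Cdl'',
  ''Tkgfeabcdlkghijbcdl Ccl Tkgfeabdclkghijbdcl Sck 4cbdkgfea Sdk 4dbckgfea Sek 0ekgf Shk'',
  ''Nhkgfeabji Sik 0ikgh Sjk Tdbaefghijdcbaefgkj Xb Cil Tkbaefghilkgfeabjil Cel'',
  ''Tkbjihgfelkghijbael F Xe D Xl Clm Tjbkgfealmjihgfealm Shl Tdcbalhgfedcbjihgfe Sjl 0jlab D D D'',
  ''D Xk Sbk Tdbaefghijdcbkfghij Sck Nckfghijbd Sdk Ndkfghijbc Sek Nekfghijba Sgk Ngkfeabjih Shk'',
  ''0hkfg Sik Tcbaefghikcdbjihgfk Sjk Tdcbaefghidcbaefkji Xl Sbl Tcbaefghijcblkfghij Scl'',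
  ''Nclkfghijb Sdl Ndlkfghijb Sel 0elkf Sgl 0glkf Shl Nhlkfeabji Sil Tdcbaefghidcbaefkli Sjl'',
  ''Tdbaefghijdcbaefklj Xm Cmn Tjbaefklmnjihgfklmn Sbm Nbmlkfghij Scm Ncmlkfeabd Sdm Ndmlkfeabc'',
  ''Sem Tcbjihgfemcdbaefklm Sgm Tcbaefgmlkcbjihgmlk Shm Tcbaefghmlcbjihgfkl Sim Nimlkfeabj Sjm'',
  ''Tcbaefghijcbaefklmj D D D D Xk Sbk Nbkjihgfea Sfk Tdcbaefghidcbaefkji Sgk Tcbaefgkjicdbaefghi'',
  ''Shk 0hkji Xc Sah 3ahgfebckji Sai 2bcdaijk Saj 1bcdajk Sak 0akcb Sbg 3bgfeackjih Sbh 2bcdhijk'',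
  ''Sbi 1bcdijk Sbj 0bjkc Sdk 0dkcb Sei 3eihgfabckj Sej 2bcdaejk Sek 1cbdkea Sfj 3fjihgeabck Sik'',
  ''Nikcbaefgh Jad Xb F Xc F Xl Sel 0elba Sfl Nflbckjihg Sgl Nglbdckjih Shl 4bcdlhijk Sil 2bcdlijk'',
  ''Sjl Njlbaefghi Skl 0klbc Xm Cmn Thgfeablmnhijkcblmn Sem Teabdckjihemlbckjih Sfm'',
  ''Tfeabckjihfmlbckjih Sgm Ngmlbckjih Shm Nhmlbdckji Sim Nimlbaefgh Sjm 2cbdkjml Skm 1cbdkml D D'',
  ''D Xl Clm Thgfeabdlmhijkcbdlm Scl 0cldb Sel 1dbclea Sfl Nfldckjihg Sgl Ngldbckjih Shl'',
  ''Nhldcbaefg Sil Nildbaefgh Sjl 1dcbljk Skl 0kldc D D Xe Xf Xg Xh Xi Xj Xk D Xl Sdl 1dcbljk D D'',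
  ''Xl Sbl 2bcdlijk Scl Nclihgfeab F Xb F D Xc F D Xm Slm 4dcbmlijk F D D D Xl Clm'',
  ''Tdbaefghlmdbckjihlm Sbl 4bcdlhijk Scl Nclhgfeabd Sil Tcbaefghlicdbaefghi Sjl 0jlhi Skl'',
  ''Nklhgfeabc D D Xl Clm Tdcbaefglmdckjihglm Sbl Nblghijkcd Scl 4cbdlgfea Shl Thgfeabdckhlgfeabck'',
  ''Sil 0ilgh Sjl Njlgfeabck Skl Nklgfeabdc D D Xl Sbl Nblfghijkc Scl 2cbdlfea Sgl'',
  ''Tgfeabdckjglfeabckj Shl 0hlfg Sil Nilfeabckj Sjl Njlfeabdck Skl 4cbdklfea Xm Cmn'',
  ''Tkcbaeflmnkjihgflmn Sbm Tbaefghijkbmlfghijk Scm Ncmlfghijk Sgm 0gmlf Shm Thgfeabdckhmlfeabck'',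
  ''Sim Tdcbaefghidcbaeflmi Sjm Njmlfeabck Skm Nkmlfeabdc D D D Xl Sbl 0blea Scl Nclefghijk Sfl'',
  ''Tfeabdckjifleabckji Sgl 0glef Shl Nhleabckji Sil Nileabdckj Sjl 4cbdkjlea Skl 2cbdklea Xm Cmn'',
  ''Tjihgfelmnjkcbaelmn Sbm Tihgfeabmlijkcdbael Scm 2cbdmlea Sfm 0fmle Sgm Tgfeabdckjgmleabckj Shm'',
  ''Thgfeabckjhmleabckj Sim Nimleabckj Sjm Njmleabdck Skm Nkmlefghij D D D Xl Sbl'',
  ''Tcblaefghicdbaefghi Scl 0clab Sel Teabdckjihelabckjih Sfl 0flae Sgl Nglabckjih Shl Nhlabdckji'',
  ''Sil 4bcdalijk Sjl 2cbdkjla Skl Nklaefghij Xm Cmn Tihgfealmnijkcbalmn Sbm 0bmla Scm 1cbdmla Sem'',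
  ''0emla Sfm Tfeabdckjifmlabckji Sgm Tgfeabckjigmlabckji Shm Nhmlabckji Sim Nimlabdckj Sjm'',
  ''Njmlaefghi Skm 2cbdkmla D D D D D D D D D D D'']"
  by code_simp

text \<open>There are no triangles any more, so five-cycles are induced. Once they are excluded, longer cycles have few
chords: a chord of a ten-cycle can only join opposite vertices, and an eight-cycle has no chords at all.\<close>

lemma no_cycle5_cert: "refutes
    [clique ''abc'', cycle ''abcd'', glued_cycles ''cde'' ''fghij'',
    glued_cycles ''cde'' ''fgh''] (cycle ''abcde'') [
  ''Sac 0acb Sad 0ade Sbd 0bdc Sbe 0bea Sce 0ced Jac Xb Xf Saf 0afb Scf 0cfb Sdf 1dfbc Sef 1efba'',
  ''Xg Sag 1agfb Sbg 0bgf Scg 1cgfb F Xd Xe F Xh Sah 3bahgfcde Sch 3bchgfaed Sfh 0fhg Xi Sai'',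
  ''Naihgfbcde Sci Ncihgfbaed Sfi 1fihg Sgi 0gih Xe Sdg 3dgfbceih Sdh 1dhie Sdi 0die Seg 1eghi Seh'',
  ''0ehi Jbg F Xf Xj Saj 1ajfb Scj Ncjfghieab Sdj 2bfjdcaeihg Sej Tcbaejfghicdeabfghi Shj 1hjfg'',
  ''Sij Tcbaeijfghcdeabfjih Xk Ckl Taedcbfjklaeihgfjkl Sak 3bakjfcde Sck Nckjfghied Sdk'',
  ''Taeihgfbcdaeihgfjkd Sek Tcdeabfghicdekjfghi Shk Nhkjfbcdei Sik Tcdeabfghicdeabfjki D D D Xh Xi'',
  ''Xe Xa Xj Scj Ncjaeihgfb Sdj Ndjabfghie Sfj 1fjab Xk Ckl Tiedcbajklihgfbajkl Sck 2abckjeihgf'',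
  ''Sdk 2aedkjbfghi Sfk 3abfkjedc D D D Xd Xc Xj Cjk Tgfbaedcjkghieabcjk Saj Najcbfghie Sfj'',
  ''Nfjcbaeihg D D Xj Cjk Thgfbaedjkhieabcdjk Saj Najdeihgfb Scj Ncjdeihgfb Sfj 2bfjdcaeihg D D Xj'',
  ''Saj 0aje Scj 1cjed Sdj Ndjeihgfbc Sfj Tcbaejfghicdeabfghi Xk Sak Nakjeihgfb Sck Nckjeihgfb Sdk'',
  ''1dkje Sfk Tabcdejkfgabfkjeihg Xl Clm Tfbcdejklmfghiejklm Sal 2ealkjihgfb Scl'',
  ''Tihgfbcdejihgfbclkj Sdl 3edlkjabc Sfl Tdcbaeihgfdcbaejklf D D D D Xj Saj 1ajie Scj 2eijcdabfgh'',
  ''Sdj Ndjihgfbae Sej Nejihgfbcd Sfj Tdcbaeijfgdeabfjihg Xk Ckl Tabcdeijklabfghijkl Sak 3eakjidcb'',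
  ''Sck Tabfghiedcabfghijkc Sdk Ndkjihgfbc Sek Nekjihgfba Sfk Tdcbaeihgfdcbaeijkf D D D Xj Cjk'',
  ''Tdcbaeihjkdeabfghjk Saj Najhgfbcde Scj Ncjhgfbaed Sdj 3edjhiabc Sej 1ejhi Sfj 1fjhg Sij'',
  ''Nijhgfbcde D D Xj Cjk Tcbaeihgjkcdeabfgjk Saj Najghiedcb Scj 3bcjgfaed Sdj Ndjghieabc Sej'',
  ''Tabcdejghiaedcbfghi Sfj Nfjghiedcb Shj Nhjgfbcdei Sij 1ijgh D D D D D Xh Seh 0ehd Xi Sei 1eihd'',
  ''Xj Sgj Ngjihdeabf F D D D D Xh Sah 1ahcb Sdh 0dhc Seh 1ehcd Sfh 1fhcb Sgh 3bchgfaed Xi Sbi'',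
  ''1bihc Sci 0cih Sdi 1dihc Sfi 3cbfihdea Sgi Ngihcdeabf Xe Cgj Thcdeabfgjhiedcbfgj Sdg'',
  ''Ndgfbaeihc F D Xj Saj Tgfbaedchigfbcdeaji Sbj 3cbjihdea Scj 1cjih Sdj 3cdjihbae Seg'',
  ''Tfbaedchijfgeabchij Sfj Nfjihcdeab Sgj 2bcdeafgjih Shj 0hji Xe F D Xk Sbk Nbkjihcdea Sdg'',
  ''Tdeabchijkdgfbchijk Sdk Ndkjihcbae Sek Tgfbaedchigfbcdekji Sfk 2bcdeafkjih Shk 1hkji Sik 0ikj'',
  ''F Xk Ckl Taedcbfgklaedchijkl Cjl Tdeabchijldeabfgkjl Cdl Tjihcbaedljkgfbaedl Cal'',
  ''Tkgfbcdealkjihcdeal Sai 2abcdeijkgf Sak 3bakgfcde Sck 3ckgfbhij Sei Neijkgfbcd Sej'',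
  ''Tedcbfgkjiejkgfbchi Jbe F Xa D Xd Xc Xh Xi Xj Xk Xg F D D D Xl Sfl Nflihcdeab Sgl 2bcdeafglih'',
  ''Xm Sfm 2bcdeafmlih Sgm Teabchijkgeabchilmg Xn Sbn Nbnmlijkgf F D D D D Xl Sfl 3cbflhdea Sgl'',
  ''Nglhcdeabf Sil Nilhcbfgkj Xm Sfm Nfmlhcdeab Sgm 2bcdeafgmlh Sim 1imlh Xn Cno'',
  ''Tgfbchlmnogkjihlmno Sfn Nfnmlhijkg F Xa D Xf D Xo D D D D D Xl Sfl 1flcb Sgl 3bclgfaed Shl'',
  ''Nhlcbfgkji Sil 1ilch Xm Sfm Nfmlchijkg Sgm Ngmlcdeabf Shm 1hmlc Sim Nimlcbfgkj Xn Cno'',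
  ''Tkgfbclmnokjihclmno Sfn Nfnmlcdeab Sgn Ngnmlchijk Shn Tdcbfgkjihdeabclmnh Sin'',
  ''Tdeabclmnideabfgkji D D D D D Xl Clm Tjihcbaelmjkgfbaelm Scl 1cled Sfl Tfbaedchijfleabchij Sgl'',
  ''Ngledchijk Shl Thcdeabfgkhledcbfgk Sil Nileabfgkj D D D D D D D D D Xe Xd Xf Saf 1afde Sbf'',
  ''1bfdc Scf 0cfd Sef 0efd Xg Scg 1cgfd Sdg 0dgf Seg 1egfd F Xb F Xh Sch 3dchgfeab Seh 3dehgfcba'',
  ''Sfh 0fhg Xi Sci Ncihgfdeab Sei Neihgfdcba Sfi 1fihg Sgi 0gih Xb Sag 3aghibedf Sah 1ahib Sai'',
  ''0aib Sbg 1bghi Sbh 0bhi Jdg F Xf Xj Saj 2dfjaecbihg Sbj Teabcdfghiedcbjfghi Scj 1cjfd Sej'',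
  ''Nejfghibcd Shj 1hjfg Sij Teabcdfjihedcbijfgh Xk Ckl Tcbaedfjklcbihgfjkl Sak'',
  ''Taedfghibcakjfghibc Sbk Teabcdfghieabkjfghi Sck 3dckjfeab Sek Nekjfghiba Shk Nhkjfdeabi Sik'',
  ''Teabcdfghieabcdfjki D D D Xh Xi Xb Xa Xe Xj Cjk Tgfdcbaejkghibcdejk Scj Ncjedfghib Sfj'',
  ''Nfjedcbihg D D Xj Cjk Thgfdcbajkhibcdeajk Scj Ncjabihgfd Sej Nejabihgfd Sfj 2dfjaecbihg D D Xc'',
  ''Xj Saj Najcdfghib Sej Nejcbihgfd Sfj 1fjcd Xk Ckl Tfdeabcjklfghibcjkl Sak 2cbakjdfghi Sek'',
  ''2cdekjbihgf Sfk 3cdfkjbae D D D Xj Saj Najbihgfde Scj 0cjb Sej 1ejba Sfj Teabcdfghiedcbjfghi'',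
  ''Xk Sak 1akjb Sck Nckjbihgfd Sek Nekjbihgfd Sfk Tcdeabjkfgcdfkjbihg Xl Clm Tfdeabjklmfghibjklm'',
  ''Sal 3balkjcde Scl 2bclkjihgfd Sel Taedcbihgfaelkjbcdf Sfl Tcdeabihgfcdeabjklf D D D D Xj Saj'',
  ''Najihgfdcb Sbj Nbjihgfdea Scj 1cjib Sej 2bijeacdfgh Sfj Tabcdfjihgaedcbijfg Xk Ckl'',
  ''Tcdeabijklcdfghijkl Sak Nakjihgfde Sbk Nbkjihgfdc Sck 3bckjiaed Sek Tcdfghibaecdfghijke Sfk'',
  ''Tcdeabihgfcdeabijkf D D D Xj Cjk Tabcdfghjkaedcbihjk Saj 3bajhicde Sbj 1bjhi Scj Ncjhgfdeab'',
  ''Sej Nejhgfdcba Sfj 1fjhg Sij Nijhgfdeab D D Xj Cjk Teabcdfgjkedcbihgjk Saj Najghibcde Sbj'',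
  ''Tcbaedfghicdeabjghi Scj Ncjghibaed Sej 3dejgfcba Sfj Nfjghibaed Shj Nhjgfdeabi Sij 1ijgh D D D'',
  ''D D Xh Sbh 0bhc Xi Sbi 1bihc Xj Sgj 2dcbaefgjih F D D D D D D Xf Saf 0afe Sbf 1bfea Scf 1cfed'',
  ''Sdf 0dfe Xg Sag 1agfe Sdg 1dgfe Seg 0egf Xb Scg 0cgb Xh Sah 0ahb Sch 0chb Sdh 1dhbc Seh 1ehba'',
  ''Sfh 1fhbg Sgh 0ghb Xi Sai 1aihb Sci 1cihb Sgi 1gihb Xd Cij Tgfeabcdijgfedcbhij Chj'',
  ''Tfeabcdihjfgbaedihj Cgj Tidcbaefgjihbcdefgj Cfj Thidcbaefjhideabgfj Sei 0eid Sfi 1fide Jeg F'',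
  ''Xb F Xa Xj Cjk Tfedihbajkfgbcdeajk Scj 1cjab Sdj Ndjaefgbhi D D Xd Xc Xj Cjk'',
  ''Tfedihbcjkfgbaedcjk Saj 1ajcb D D Xi Xh D D Xj Saj Najdihbgfe Scj 0cjd Xk Ckl'',
  ''Tfeabcdjklfgbaedjkl Sak Nakjdcbgfe Sck 1ckjd D D D Xf D Xj Saj 0aje Scj Ncjefgbhid Sdj 0dje Xk'',
  ''Ckl Tidcbaejklihbcdejkl Sak 1akje Sck Nckjeabhid Sdk Ndkjefgbhi D D D Xf D D Xj Scj Ncjihbgfed'',
  ''D D D D Xh Sdh 3edhgfabc Xb Xi Sdi 1dibc Xj Scj Ncjibhgfed D D D Xi Sdi Ndihgfeabc Xb Xj Scj'',
  ''Ncjbihgfed D D Xj Sbj Nbjihgfedc Sdj 2deabcjihgf Xk Sck Nckjihgfed D D D D D D D Xf Sbf 0bfa'',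
  ''Scf 1cfab Sdf 1dfae Sef 0efa Xg Sag 0agf Sbg 1bgfa Seg 1egfa F Xb Xh Sch 0chb Sdh 1dhbc Seh'',
  ''1ehba Sfh 1fhba Sgh 3abhgfedc Xi Sai 1aihb Sbi 0bih Sci 1cihb Sfi 3bafihcde Sgi Ngihbcdeaf F'',
  ''Xd Cij Tfaedcbhijfgdeabhij Sei Neihbcdgfa F D Xj Saj 1ajgf Sbj 3abjgfedc Scj'',
  ''Tgfaedcbhigjcdeabhi Sdi Thbcdeafgjhidcbafgj Sej 3aejgfbcd Sfj 0fjg Shj Nhjgfaedcb Sij'',
  ''2baedchijgf Xd D Xk Sbk Nbkjgfaedc Sdk Tgfaedcbhigjkdeabhi Sei Tedcbafgjkeihbafgjk Sek'',
  ''Nekjgfabcd Sfk 1fkjg Sgk 0gkj Shk 2baedchkjgf Xi Ckl Tcdeabhiklcdeafgjkl Cjl'',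
  ''Tedcbafgjledcbhikjl Cel Tjgfabcdeljkihbcdel Ccl Tkihbaedclkjgfaedcl Sak 3akihbfgj Scg'',
  ''2cbaedgjkih Sck 3bckihaed Sdg Ndgjkihbae Sdj Tdeabhikjgdjkihbafg Jad F Xc Xb Xh Xi Xk Xj Xg F'',
  ''D D D Xl Sfl Nflihbcdea Sgl 2abcdefglih Xm Sfm 2abcdefmlih Sgm Tdeabhikjgdeabhilmg Xn San'',
  ''Nanmlikjgf F D D D D Xl Sfl 3baflhcde Sgl Nglhbcdeaf Sil Nilhbafgjk Xm Sfm Nfmlhbcdea Sgm'',
  ''2abcdefgmlh Sim 1imlh Xn Cno Tgfabhlmnogjkihlmno Sfn Nfnmlhikjg F Xe D Xf D Xo D D D D D Xl'',
  ''Sfl 1flba Sgl 3ablgfedc Shl Nhlbafgjki Sil 1ilbh Xm Sfm Nfmlbhikjg Sgm Ngmlbcdeaf Shm 1hmlb'',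
  ''Sim Nimlbafgjk Xn Cno Tjgfablmnojkihblmno Sfn Nfnmlbcdea Sgn Ngnmlbhikj Shn'',
  ''Tcbafgjkihcdeablmnh Sin Tcdeablmnicdeafgjki D D D D D Xe D Xl Clm Tjgfabcdlmjkihbcdlm Sbl'',
  ''1bldc Sfl Tfaedcbhikfldeabhik Sgl Ngldcbhikj Shl Thbcdeafgjhldcbafgj Sil Nildeafgjk D D D D D'',
  ''D D Xd F Xh Sbh 3abhgfedc Seh 3aehgfbcd Xi Sbi Nbihgfaedc Sei Neihgfabcd Xj Sbj 2baedcjihgf'',
  ''Sej 2eabcdjihgf Xk Sdk Ndkjihgfae D D D D D Xh Sbh 0bhc Sdh 0dhc Seh 1ehcd Xi Sbi 1bihc Sdi'',
  ''1dihc F Xd Cij Tgdeabchijgfaedchij Sei Neihcbafgd F D Xj Sbj 3abjgfedc Sei Tiedcbafgjihcdeafgj'',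
  ''Sej 3aejgfbcd F Xk Sdj Tjdeabchikjgfabchik F Xl Skl Tbaedchiklbcdeafgjl D D D D D D D D'']"
  by code_simp

lemma no_cycle10_cert: "refutes
    [clique ''abc'', cycle ''abcd'', glued_cycles ''cde'' ''fghij'', cycle ''abcde'']
    (cycle ''abcdefghij'') [
  ''Sac Nacdefghij Sad 1adcb Sae 2aedcbjihgf Sag 2aghijbcdef Sah 1ahij Sai Naihgfedcb Sbd'',
  ''Nbdefghija Sbe 1bedc Sbf 2bfedcajihg Sbh 2bhijacdefg Sbi 1bija Sbj Nbjihgfedc Sce Ncefghijab'',
  ''Scf 1cfed Scg 2cgfedbajih Sci 2cijabdefgh Scj 1cjab Sdf Ndfghijabc Sdg 1dgfe Sdh 2dhgfecbaji'',
  ''Sdj 2djabcefghi Seg Neghijabcd Seh 1ehgf Sei 2eihgfdcbaj Sfh Nfhijabcde Sfi 1fihg Sfj'',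
  ''2fjihgedcba Sgi Ngijabcdef Sgj 1gjih Shj Nhjabcdefg Saf Cjk Tcbafghijkcdefghijk Cik'',
  ''Tbcdefajikbcdefghik Chk Tedcbafghkedcbajihk Cgk Tdcbajihgkdefajihgk Cek Thgfabcdekhijabcdek'',
  ''Cdk Tghijabcdkghijafedk Cck Tjihgfabckjihgfedck Cbk Tihgfedcbkijafedcbk Sbg 1bgfa Sch'',
  ''Tbajihgfedbchijafed Sdi Tbcdefghijbcdihgfaj Sej 1ejaf Jad F Xc Xb D D Xe Xf Xg Xh Xi Xj D D D'',
  ''D Xk Xl Clm Tabcdefklmajihgfklm D D D D D Jbh Xa Xj Xe Cik Tbajefghikbcdefghik Chk'',
  ''Tabcdefghkabcdejihk Cgk Tdcbajefgkdcbajihgk Cfk Tcbajihgfkcdejihgfk Sch Tabcdefghiabchgfeji'',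
  ''Sdi 1dije F Xg Xf D D Xi D D Xi Xd Cjk Tgfedcbajkghidcbajk Chk Tabcdefghkajidefghk Cgk'',
  ''Tjabcdefgkjabcdihgk Cfk Tcbajidefkcbajihgfk Cek Tbajihgfekbcdihgfek Cck Tfedijabckfghijabck'',
  ''Cbk Tefghidcbkefghijabk Cak Thgfedcbakhgfedijak Sbg Thgfedcbajhidefgbaj Sch 1chid Sej 1ejid'',
  ''Jdg F Xf Xe D D Xh Xi Xj Xa Xb Xc D D D D Xk Xl Clm Tdcbajiklmdefghiklm D D D D D Xk Sch'',
  ''Tfedcbajikfghcbajik Sck Tbajihgfedbckihgfed Sek Thgfedcbajhikedcbaj Sfk Nfkijabcde Sgk 1gkih'',
  ''Xd Chl Tjabcdkihljikdefghl Cgl Tabcdkihglajikdefgl F Xg Xf F D D D Xl Clm Tdcbajiklmdefghiklm'',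
  ''Scl Nclkihgfed Sdl Tcbajihgfecbajiklde Sel Nelkijabcd Sfl Tdcbajihgfdcbajiklf Sgl 3glkih D D D'',
  ''Xk Sch Tgfedcbajkgfedchijk Sck Nckjihgfed Sdi Tgfedcbajkghidcbajk Sdk Tcbajihgfecdkjihgfe Sfk'',
  ''Tabcdefghiabcdefkji Sgk Ngkjabcdef Sik 0ikj Xe Cil Tabcdekjilajkefghil Chl Tbajkefghlbcdekjihl'',
  ''Cgl Tcbajkefglcdekjihgl Cfl Tdcbajkefldekjihgfl F Xg Xf D D Xi D D Xl Clm Tedcbajklmefghijklm'',
  ''Scl Tcbajihgfeclkjihgfe Sdl Ndlkjihgfe Sel Tdcbajihgfdcbajklef Sfl Nflkjabcde Sgl'',
  ''Tedcbajihgedcbajklg Sil 1ilkj D D D Xk Sch Tdefghcbakdefghijak Sck 1ckab Sdi'',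
  ''Thgfedcbakhgfedijak Sdk Ndkajihgfe Sej Thgfedcbakhijedcbak Sek Tdcbajihgfdekajihgf Sgk'',
  ''Tbcdefghijbcdefgkaj Sik 1ikaj Sjk 0jka Xf Cjl Tbakfghijlbcdefkajl Cil Tcbakfghilcdefkajil Chl'',
  ''Tdcbakfghldefkajihl Cgl Tedcbakfglefkajihgl F Xg D Xi Xj D D D Xl Clm Tfedcbaklmfghijaklm Scl'',
  ''3clkab Sdl Tdcbajihgfdlkajihgf Sel Nelkajihgf Sfl Tedcbajihgedcbaklfg Sgl Nglkabcdef Sil'',
  ''3ilkaj Sjl 1jlka D D D Xc Xd Xe Xf Xg Xk Sik 1ikgh F Xi F D Xl Skl 1klhg F D D D Xk Sgk 0gkf'',
  ''Sik Nikfedcbaj Sjk Tedcbajihgedcbajkfg Xa Chl Tdcbakfghldefkajihl Xj D Xl D D Xl Clm'',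
  ''Tabcdefklmajihgfklm Sgl 1glkf Sil Tabcdefghiabcdefkli F Xg F D Xi F D Xm F D D D D Xj Cik'',
  ''Tbajefghikbcdefghik Chk Tabcdefghkabcdejihk Cgk Tdcbajefgkdcbajihgk Cfk Tcbajihgfkcdejihgfk F'',
  ''Xg Xf D D Xi D D Xk Sak Tbakefghijbcdefghij Sfk 0fke Sgk 1gkef Sik Thgfedcbajhikedcbaj Xj Cil'',
  ''Tabcdekjilajkefghil Chl Tbajkefghlbcdekjihl Cgl Tcbajkefglcdekjihgl F Xg Xf F D D Xi D D Xl'',
  ''Clm Tjabcdeklmjihgfeklm Sal Nalkefghij Sfl 1flke Sgl 3glkef Sil Nilkedcbaj Sjl'',
  ''Tabcdefghiabcdeklji D D D Xi Chk Tabcdefghkajidefghk Cgk Tjabcdefgkjabcdihgk Cfk'',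
  ''Tcbajidefkcbajihgfk Cek Tbajihgfekbcdihgfek Sej 1ejid F Xg Xf Xe D D D D Xk Sak Nakdefghij Sek'',
  ''0ekd Sfk 1fkde Sgk Ngkdcbajih Sjk Tabcdefghiajkdefghi Xi Chl Tjabcdkihljikdefghl Cgl'',
  ''Tabcdkihglajikdefgl Cfl Tbajikdeflbcdkihgfl F Xg Xf Xe F D D D D Xl Clm Tihgfedklmijabcdklm'',
  ''Sal Tabcdefghialkdefghi Sel 1elkd Sfl 3flkde Sgl Tgfedcbajiglkdcbaji Sil Thgfedcbajhgfedklij'',
  ''Sjl Njlkdefghi D D D Xk Sak 1akcb Sdk 0dkc Sek 1ekcd Sfk Nfkcbajihg Sgk Tfedcbajihfgkcbajih'',
  ''Sik Tbajihgfedbckihgfed Sjk Njkcdefghi Xl Clm Thgfedcklmhijabcklm Sal 3alkcb Sdl 1dlkc Sel'',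
  ''3elkcd Sfl Tfedcbajihflkcbajih Sgl Nglkcbajih Sil Nilkcdefgh Sjl Thgfedcbajhgfedcklj D D D Xg'',
  ''Cjk Tcdefgbajkcdefghijk Cik Tfedcbajikfedcbghik Chk Tedcbajihkefgbajihk Cak'',
  ''Tdcbghijakdefghijak Sch 1chgb Sdi Tcbajihgfecdijabgfe Sej Tcbajefghicdefgbaji F Xi Xj Xa D D D'',
  ''D Xk Sak 0akb Sch Tedchijabkefghijabk Sck 0ckb Sdi Tefghidcbkefghijabk Sdk 1dkbc Sej'',
  ''Tihgfedcbkihgfejabk Sek Nekbajihgf Sfk Tedcbajihgefkbajihg Sik Nikbcdefgh Sjk 1jkba Xg Cjl'',
  ''Tdcbkghijldefgkbajl Cil Tedcbkghilefgkbajil Chl Tfedcbkghlfgkbajihl Cal Tcbkghijalcdefgkbal F'',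
  ''Xi Xj Xa D D D D Xl Clm Tgfedcbklmghijabklm Sal 1alkb Scl 1clkb Sdl 3dlkbc Sel'',
  ''Tedcbajihgelkbajihg Sfl Nflkbajihg Sgl Tfedcbajihfedcbklgh Sil Tgfedcbajigfedcbkli Sjl 3jlkba'',
  ''D D D'']"
  by code_simp

lemma no_cycle8_cert: "refutes
    [clique ''abc'', cycle ''abcd'', glued_cycles ''cde'' ''fgh'', cycle ''abcde'',
    cycle ''abcdefghij''] (cycle ''abcdefgh'') [
  ''Sac 0acb Sad 1adcb Sae 2aedcbhgf Saf 1afgh Sag 0agh Sbd 0bdc Sbe 1bedc Sbf 2bfghacde Sbg 1bgha'',
  ''Sbh 0bha Sce 0ced Scf 1cfed Scg 2cghabdef Sch 1chab Sdf 0dfe Sdg 1dgfe Sdh 2dhabcefg Seg 0egf'',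
  ''Seh 1ehgf Sfh 0fhg Jac Xb Xi Sdi 1dibc Sei 3eibcd Sgi 3gibah Shi 1hiba Xf Chj'',
  ''Tibcdefghjifedcbahj Cdj Tibahgfedjifghabcdj F Xd Xe Xj Cjk Tgfibcdejkghabcdejk Sgj 1gjef D D D'',
  ''Xj Cjk Tabifedcjkahgfedcjk Sej 1ejcd Sgj 4gjcdefibah D D Xj Sdj Ndjibahgfe Sej'',
  ''Tcbahgfejicdefghabi Sgj Tabcdefgjiahgfedcbi Shj Nhjibcdefg Xf Cek Tgfjibcdekghabijfek Cdk'',
  ''Thabijfedkhgfjibcdk Cck Tabijfedckahgfjibck F Xd Xe D D D Xk Ckl Tfedcbijklfghabijkl Sdk'',
  ''4dkjibahgfe Sek Nekjibahgf Sfk Tabcdefkjiahgfedcbi Sgk Ngkjibcdef Shk 4hkjibcdefg D D D D Xh'',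
  ''Xg Xf Xe Xd Xi Sbi 1bidc Xj Scj 1cjid D D D Xi Sbi 3biedc Sdi Ndiefghabc Xj Sbj'',
  ''Tdcbahgfeidefghabji Sdj 1djie Xk Sck 4ckjiefghab D D D D Xi Sdi 1dife Sei Neifghabcd Xb Cdj'',
  ''Tibahgfedjifghabcdj Xj Sej 3ejbcd Xk Sck 1ckjb D D D Xj Sdj Ndjifghabc Sej 1ejif Xb Cck'',
  ''Tabjifedckahgfijbck Xk D D Xk Ckl Tbahgfijklbcdefijkl Sbk Tedcbahgfiefghabkji Sdk 4dkjifghabc'',
  ''Sek 3ekjif D D D D Xi Sbi 3bigha Sdi 3digfe Sei 1eigf Sfi Nfighabcde Xj Sbj'',
  ''Thabcdefgihgfedcbji Sdj Tfedcbahgifghabcdji Sej Nejighabcd Sfj 1fjig Xk Ckl'',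
  ''Tcbahgijklcdefgijkl Sbk Nbkjigfedc Sdk Ndkjighabc Sek 4ekjighabcd Sfk 3fkjig D D D D Xi Sbi'',
  ''1biha Sei 3eihgf Sfi 1fihg Sgi Ngihabcdef Xd Cfj Tidcbahgfjihabcdefj Cbj Tidefghabjihgfedcbj F'',
  ''Xb D Xj Cjk Tedihabcjkefghabcjk Sej 1ejcd Sgj 4gjcbahidef D D Xj Sbj Nbjihgfedc Sej'',
  ''Tgfedcbahighabcdeji Sfj Nfjihabcde Sgj 1gjih Xd Cck Tedjihabckefghijdck Cbk'',
  ''Tfedjihabkfghijdcbk F Xb D D Xk Ckl Tdcbahijkldefghijkl Sbk 4bkjihgfedc Sdk'',
  ''Tgfedcbahighabcdkji Sek Nekjihabcd Sfk 4fkjihabcde Sgk 3gkjih D D D D Xi Sbi Nbiahgfedc Sdi'',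
  ''3diabc Sfi 3fiahg Sgi 1giah Shi Nhiabcdefg Xe Cgj Tiabcdefgjiedcbahgj Ccj Tiahgfedcjiefghabcj'',
  ''F Xb Xj Cjk Thaiedcbjkhgfedcbjk Sdj 1djbc Sfj 4fjbcdeiahg Shj 1hjba D D Xd Xj Cjk'',
  ''Tfeiabcdjkfghabcdjk Sbj 1bjdc Sfj 1fjde Shj 4hjdcbaiefg D D D Xj Sbj 1bjia Sdj'',
  ''Tbahgfedjibcdefghai Sfj Thabcdefjihgfedcbai Sgj Ngjiabcdef Shj 1hjia Xe Cdk'',
  ''Tfejiabcdkfghaijedk Cck Tgfejiabckghaijedck Cbk Thaijedcbkhgfejiabk F Xb D Xd D D Xk Ckl'',
  ''Tedcbaijklefghaijkl Sbk 3bkjia Sdk Ndkjiahgfe Sek Thabcdekjihgfedcbai Sfk Nfkjiabcde Sgk'',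
  ''4gkjiabcdef Shk 3hkjia D D D D'']"
  by code_simp

text \<open>The pendant clique of two vertices is an induced path of length two.\<close>

lemma no_pendant_clique2_cert: "refutes
    [clique ''abc'', cycle ''abcd'', cycle ''abcde'', cycle ''abcdefghij'', cycle ''abcdefgh'']
    (pendant_clique ''abc'') [
  ''Jac Xb Xd Xe Xf Xg Xh Xi Sci 4cihgfedb D D D D D D D Xd Sbd 0bda Xe Sbe 1beda Xf Sbf 2bfeda Xg'',
  ''F Xb F Xh Xi Sbi 4bihgfeda D D D Xh Sbh 0bhc Xi Sbi 1bihc Xj Sgj 3gjihcbadef F D D D D D D D D'']"
  by code_simp

context unique_eight_paths
begin

text \<open>Starting from the nine-cycle in a clique of nine vertices, cliques of eight, seven, \<open>\<dots>\<close>, two vertices are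
excluded one after the other; in between come the configurations that the certificates refer to.\<close>

theorem inconsistent: False
proof -
  have no_clique9: "forbidden (clique ''abcdefghi'')"
    by (rule forbidden_if_refutes[OF no_clique9_cert]) simp
  have no_diamond: "forbidden diamond"
    by (rule forbidden_if_refutes[OF no_diamond_cert]) simp
  have no_square: "forbidden square"
    by (rule forbidden_if_refutes[OF no_square_cert]) simp
  have no_pendant_clique8: "forbidden (pendant_clique ''abcdefghi'')"
    by (rule forbidden_if_refutes[OF no_pendant_clique8_cert]) simp
  have no_clique8: "forbidden (clique ''abcdefgh'')"
    by (rule forbidden_clique_step[OF no_diamond no_clique9 no_pendant_clique8]) simp_all
  have no_pendant_clique7: "forbidden (pendant_clique ''abcdefgh'')"
    by (rule forbidden_if_refutes[OF no_pendant_clique7_cert]) simp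
  have no_clique7: "forbidden (clique ''abcdefg'')"
    by (rule forbidden_clique_step[OF no_diamond no_clique8 no_pendant_clique7]) simp_all
  have no_ear2_on_clique6: "forbidden (clique_with_ear ''abcdef'' ''g'')"
    by (rule forbidden_if_refutes[OF no_ear2_on_clique6_cert]) (simp add: no_diamond no_clique7)
  have no_ear3_on_clique6: "forbidden (clique_with_ear ''abcdef'' ''gh'')"
    by (rule forbidden_if_refutes[OF no_ear3_on_clique6_cert])
      (simp add: no_square no_ear2_on_clique6)
  have no_pendant_clique6: "forbidden (pendant_clique ''abcdefg'')"
    by (rule forbidden_if_refutes[OF no_pendant_clique6_cert])
      (simp add: no_ear2_on_clique6 no_ear3_on_clique6)
  have no_clique6: "forbidden (clique ''abcdef'')"
    by (rule forbidden_clique_step[OF no_diamond no_clique7 no_pendant_clique6]) simp_all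
  have no_ear2_on_clique5: "forbidden (clique_with_ear ''abcde'' ''f'')"
    by (rule forbidden_if_refutes[OF no_ear2_on_clique5_cert]) (simp add: no_diamond no_clique6)
  have no_ear3_on_clique5: "forbidden (clique_with_ear ''abcde'' ''fg'')"
    by (rule forbidden_if_refutes[OF no_ear3_on_clique5_cert])
      (simp add: no_square no_ear2_on_clique5)
  have no_ear4_on_clique5: "forbidden (clique_with_ear ''abcde'' ''fgh'')"
    by (rule forbidden_if_refutes[OF no_ear4_on_clique5_cert])
      (simp add: no_ear2_on_clique5 no_ear3_on_clique5)
  have no_pendant_clique5: "forbidden (pendant_clique ''abcdef'')"
    by (rule forbidden_if_refutes[OF no_pendant_clique5_cert])
      (simp add: no_ear2_on_clique5 no_ear3_on_clique5 no_ear4_on_clique5)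
  have no_clique5: "forbidden (clique ''abcde'')"
    by (rule forbidden_clique_step[OF no_diamond no_clique6 no_pendant_clique5]) simp_all
  have no_ear2_on_clique4: "forbidden (clique_with_ear ''abcd'' ''e'')"
    by (rule forbidden_if_refutes[OF no_ear2_on_clique4_cert]) (simp add: no_diamond no_clique5)
  have no_ear3_on_clique4: "forbidden (clique_with_ear ''abcd'' ''ef'')"
    by (rule forbidden_if_refutes[OF no_ear3_on_clique4_cert])
      (simp add: no_square no_ear2_on_clique4)
  have no_ear4_on_clique4: "forbidden (clique_with_ear ''abcd'' ''efg'')"
    by (rule forbidden_if_refutes[OF no_ear4_on_clique4_cert])
      (simp add: no_ear2_on_clique4 no_ear3_on_clique4)
  have no_ear5_on_clique4: "forbidden (clique_with_ear ''abcd'' ''efgh'')"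
    by (rule forbidden_if_refutes[OF no_ear5_on_clique4_cert])
      (simp add: no_ear2_on_clique4 no_ear3_on_clique4 no_ear4_on_clique4)
  have no_pendant_clique4: "forbidden (pendant_clique ''abcde'')"
    by (rule forbidden_if_refutes[OF no_pendant_clique4_cert])
      (simp add: no_ear2_on_clique4 no_ear3_on_clique4 no_ear4_on_clique4 no_ear5_on_clique4)
  have no_clique4: "forbidden (clique ''abcd'')"
    by (rule forbidden_clique_step[OF no_diamond no_clique5 no_pendant_clique4]) simp_all
  have no_cycle4: "forbidden (cycle ''abcd'')"
    by (rule forbidden_if_refutes[OF no_cycle4_cert]) (simp add: no_diamond no_square no_clique4)
  have no_glued35: "forbidden (glued_cycles ''c'' ''def'')"
    by (rule forbidden_if_refutes[OF no_glued35_cert]) (simp add: no_cycle4)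
  have no_glued36: "forbidden (glued_cycles ''c'' ''defg'')"
    by (rule forbidden_if_refutes[OF no_glued36_cert]) (simp add: no_cycle4 no_glued35)
  have no_glued57: "forbidden (glued_cycles ''cde'' ''fghij'')"
    by (rule forbidden_if_refutes[OF no_glued57_cert]) (simp add: no_cycle4 no_glued35)
  have no_glued37: "forbidden (glued_cycles ''c'' ''defgh'')"
    by (rule forbidden_if_refutes[OF no_glued37_cert])
      (simp add: no_cycle4 no_glued35 no_glued36 no_glued57)
  have no_glued55: "forbidden (glued_cycles ''cde'' ''fgh'')"
    by (rule forbidden_if_refutes[OF no_glued55_cert]) (simp add: no_cycle4 no_glued35 no_glued57)
  have no_pendant_clique3: "forbidden (pendant_clique ''abcd'')"
    by (rule forbidden_if_refutes[OF no_pendant_clique3_cert])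
      (simp add: no_cycle4 no_glued35 no_glued36 no_glued57 no_glued37 no_glued55)
  have no_clique3: "forbidden (clique ''abc'')"
    by (rule forbidden_clique_step[OF no_diamond no_clique4 no_pendant_clique3]) simp_all
  have no_cycle5: "forbidden (cycle ''abcde'')"
    by (rule forbidden_if_refutes[OF no_cycle5_cert])
      (simp add: no_clique3 no_cycle4 no_glued57 no_glued55)
  have no_cycle10: "forbidden (cycle ''abcdefghij'')"
    by (rule forbidden_if_refutes[OF no_cycle10_cert])
      (simp add: no_clique3 no_cycle4 no_glued57 no_cycle5)
  have no_cycle8: "forbidden (cycle ''abcdefgh'')"
    by (rule forbidden_if_refutes[OF no_cycle8_cert])
      (simp add: no_clique3 no_cycle4 no_glued55 no_cycle5 no_cycle10)
  have no_pendant_clique2: "forbidden (pendant_clique ''abc'')"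
    by (rule forbidden_if_refutes[OF no_pendant_clique2_cert])
      (simp add: no_clique3 no_cycle4 no_cycle5 no_cycle10 no_cycle8)
  have no_clique2: "forbidden (clique ''ab'')"
    by (rule forbidden_clique_step[OF no_diamond no_clique3 no_pendant_clique2]) simp_all
  show False using no_clique2 not_forbidden_edge by blast
qed

end

theorem theorem1p1:
  shows "\<not> (\<exists>G :: 'a pair_pre_digraph. nontrivial_uniquely_cycle_saturated 9 G)"
  using unique_eight_paths_if_saturated unique_eight_paths.inconsistent by blast

end
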